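(* Let $\mathbb{G}$ be a totally ordered Abelian group with $\operatorname{Deg}(\mathbb{G})=\kappa$. For any space $X$ the following are equivalent: (a) $X$ is a $\kappa$-additive $\mathrm{SC}_\kappa$-space; (b) $X$ is both an $\mathrm{SC}_\kappa$-space and $\mathbb{G}$-Polish; (c) $X$ is a spherically ${<}\kappa$-complete $\mathbb{G}$-Polish space; (d) $X$ is a spherically complete $\mathbb{G}$-Polish space; (e) $X$ is homeomorphic to a superclosed subset of ${}^{\kappa}\kappa$.
   Context: Work in ZFC; $\kappa$ is an uncountable regular cardinal with $2^{<\kappa}=\kappa$ (equivalently $\kappa^{<\kappa}=\kappa$). "Space" means regular Hausdorff topological space. ${}^{\kappa}\kappa$ is the set of all functions $\kappa\to\kappa$ with the bounded topology, generated by the sets $\{x\in{}^{\kappa}\kappa \mid s\subseteq x\}$, $s\in{}^{<\kappa}\kappa$. A tree is a set $T\subseteq{}^{<\kappa}\kappa$ closed under initial segments; $[T]=\{x\in{}^{\kappa}\kappa\mid \forall\alpha<\kappa\ (x\restriction\alpha\in T)\}$. $T$ is pruned if every $s\in T$ has extensions in $T$ of every length $\alpha$ with $\operatorname{lh}(s)\le\alpha<\kappa$; it is ${<}\kappa$-closed if for every (nonzero) limit $\gamma<\kappa$ and $s\in{}^{\gamma}\kappa$, if $s\restriction\alpha\in T$ for all $\alpha<\gamma$ then $s\in T$; it is superclosed if it is pruned and ${<}\kappa$-closed. A closed $C\subseteq{}^{\kappa}\kappa$ is superclosed if $C=[T]$ for some superclosed tree $T$. A space is $\kappa$-additive if its topology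 is closed under intersections of fewer than $\kappa$ open sets. Strong $\kappa$-Choquet game $\mathrm{G}^s_\kappa(X)$: players I and II play $\kappa$-many rounds. In round $\alpha<\kappa$, I plays $(U_\alpha,x_\alpha)$ with $U_\alpha$ a relatively open subset of $\bigcap_{\beta<\alpha}V_\beta$ (which is $X$ if $\alpha=0$) and $x_\alpha\in U_\alpha$; then II plays a relatively open subset $V_\alpha$ of $\bigcap_{\beta<\alpha}V_\beta$ with $x_\alpha\in V_\alpha\subseteq U_\alpha$. II wins iff $\bigcap_{\alpha<\gamma}V_\alpha\ne\emptyset$ for every limit $\gamma\le\kappa$ (so I wins as soon as such an intersection is empty). $X$ is an $\mathrm{SC}_\kappa$-space if it has weight $\le\kappa$ and II has a winning strategy in $\mathrm{G}^s_\kappa(X)$. (The empty space, where I has no legal move, counts as such.) For a totally ordered (with translation-invariant linear order) Abelian group $\mathbb{G}$, $\mathbb{G}^+=\{\varepsilon\in\mathbb{G}\mid 0<\varepsilon\}$ and $\operatorname{Deg}(\mathbb{G})$ is the coinitiality of $\mathbb{G}^+$. A $\mathbb{G}$-metric on $X$ is a map $d\colon X^2\to\mathbb{G}^+\cup\{0\}$ with $d(x,y)=0\iff x=y$, $d(x,y)=d(y,x)$, $d(x,z)\le d(x,y)+d(y,z)$; its topology is generated by the balls $B_d(x,\varepsilon)=\{y\mid d(x,y)<\varepsilon\}$, $\varepsilon\in\mathbb{G}^+$, and $d$ is compatible with a topology if it generates it. $d$ is Cauchy-complete if every $d$-Cauchy sequence of length $\kappa$ converges. $d$ is spherically complete if every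 sequence of open balls decreasing with respect to inclusion has nonempty intersection; it is spherically ${<}\kappa$-complete if this holds for sequences of order type $<\kappa$. $X$ is $\mathbb{G}$-Polish if it has weight $\le\kappa$ and admits a compatible Cauchy-complete $\mathbb{G}$-metric; a $\mathbb{G}$-Polish space is spherically complete (resp. spherically ${<}\kappa$-complete) if it admits a compatible Cauchy-complete $\mathbb{G}$-metric which is also spherically complete (resp. spherically ${<}\kappa$-complete). *)

theory Defs
  imports "HOL-Analysis.Analysis"
begin

unbundle cardinal_syntax
no_notation elt_set_eq (infix \<open>=o\<close> 50)

subsection \<open>The cardinal \<open>\<kappa>\<close> and sequences of length below \<open>\<kappa>\<close>\<close>

text \<open>
  The cardinal \<open>\<kappa>\<close> is the order type of a well-ordered type \<open>'k\<close>: its elements are the ordinals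
  below \<open>\<kappa>\<close>, and \<open>{..<\<alpha>}\<close> is the ordinal \<open>\<alpha>\<close> in the sense of von Neumann.  The relation
  \<open>kappa\<close> is this well-order in the form used by the library of cardinals.
\<close>

definition kappa :: "'k::wellorder rel" where
  "kappa = {(\<alpha>, \<beta>). \<alpha> \<le> \<beta>}"

text \<open>Nonzero limit ordinals \<open>\<gamma> \<le> \<kappa>\<close>, given as sets of ordinals; \<open>UNIV\<close> stands for \<open>\<kappa>\<close> itself.\<close>

definition limit_ordinals :: "'k::wellorder set set" where
  "limit_ordinals = {\<Gamma> \<in> insert UNIV (range lessThan). \<Gamma> \<noteq> {} \<and> (\<forall>\<alpha>\<in>\<Gamma>. \<exists>\<beta>\<in>\<Gamma>. \<alpha> < \<beta>)}"

text \<open>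
  \<open>seqs\<close> is the set of all sequences of length less than \<open>\<kappa>\<close> with values in \<open>'b\<close>: a sequence
  of length \<open>\<alpha>\<close> is a partial function with domain \<open>{..<\<alpha>}\<close>.
\<close>

definition seqs :: "('k::wellorder \<rightharpoonup> 'b) set" where
  "seqs = {s. \<exists>\<alpha>. dom s = {..<\<alpha>}}"

text \<open>An uncountable regular cardinal with \<open>2\<^sup><\<^sup>\<kappa> = \<kappa>\<close>, the latter being the size of the set of
  all binary sequences of length less than \<open>\<kappa>\<close>.\<close>

definition admissible_cardinal :: "'k::wellorder itself \<Rightarrow> bool" where
  "admissible_cardinal _ \<longleftrightarrow>
     Card_order (kappa :: 'k rel) \<and> regularCard (kappa :: 'k rel) \<and> natLeq <o (kappa :: 'k rel) \<and>
     |seqs :: ('k \<rightharpoonup> bool) set| =o (kappa :: 'k rel)"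


subsection \<open>Trees and superclosed sets\<close>

definition bounded_topology :: "('k::wellorder \<Rightarrow> 'k) topology" where
  "bounded_topology = topology_generated_by {{x. s \<subseteq>\<^sub>m Some \<circ> x} | s. s \<in> seqs}"

definition is_tree :: "('k::wellorder \<rightharpoonup> 'k) set \<Rightarrow> bool" where
  "is_tree T \<longleftrightarrow> T \<subseteq> seqs \<and> (\<forall>s\<in>T. \<forall>\<alpha>. s |` {..<\<alpha>} \<in> T)"

definition body :: "('k::wellorder \<rightharpoonup> 'k) set \<Rightarrow> ('k \<Rightarrow> 'k) set" where
  "body T = {x. \<forall>\<alpha>. (Some \<circ> x) |` {..<\<alpha>} \<in> T}"

definition pruned :: "('k::wellorder \<rightharpoonup> 'k) set \<Rightarrow> bool" where
  "pruned T \<longleftrightarrow> (\<forall>s\<in>T. \<forall>\<alpha>. dom s \<subseteq> {..<\<alpha>} \<longrightarrow> (\<exists>t\<in>T. s \<subseteq>\<^sub>m t \<and> dom t = {..<\<alpha>}))"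

definition closed_below :: "('k::wellorder \<rightharpoonup> 'k) set \<Rightarrow> bool" where
  "closed_below T \<longleftrightarrow>
     (\<forall>\<gamma> s. {..<\<gamma>} \<in> limit_ordinals \<and> dom s = {..<\<gamma>} \<and> (\<forall>\<alpha><\<gamma>. s |` {..<\<alpha>} \<in> T) \<longrightarrow> s \<in> T)"

definition superclosed_tree :: "('k::wellorder \<rightharpoonup> 'k) set \<Rightarrow> bool" where
  "superclosed_tree T \<longleftrightarrow> is_tree T \<and> pruned T \<and> closed_below T"

definition superclosed :: "('k::wellorder \<Rightarrow> 'k) set \<Rightarrow> bool" where
  "superclosed C \<longleftrightarrow> closedin bounded_topology C \<and> (\<exists>T. superclosed_tree T \<and> C = body T)"


subsection \<open>Weight, additivity and the strong Choquet game\<close>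

definition weight_le :: "'a topology \<Rightarrow> 'k rel \<Rightarrow> bool" where
  "weight_le X r \<longleftrightarrow>
     (\<exists>\<B>. |\<B>| \<le>o r \<and> (\<forall>V\<in>\<B>. openin X V) \<and>
          (\<forall>U x. openin X U \<and> x \<in> U \<longrightarrow> (\<exists>V\<in>\<B>. x \<in> V \<and> V \<subseteq> U)))"

text \<open>The intersection with \<open>topspace X\<close> only matters for the empty family.\<close>

definition additive_space :: "'k rel \<Rightarrow> 'a topology \<Rightarrow> bool" where
  "additive_space r X \<longleftrightarrow>
     (\<forall>\<U>. (\<forall>U\<in>\<U>. openin X U) \<and> |\<U>| <o r \<longrightarrow> openin X (topspace X \<inter> \<Inter>\<U>))"

text \<open>
  A play of player I is \<open>p\<close>, with \<open>p \<alpha> = (U\<^sub>\<alpha>, x\<^sub>\<alpha>)\<close>.  A strategy of II maps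
  the moves of I up to and including the current round to a set; \<open>reply \<sigma> p \<alpha>\<close> is the
  resulting \<open>V\<^sub>\<alpha>\<close>.
\<close>

type_synonym ('k, 'a) strategy = "('k \<rightharpoonup> 'a set \<times> 'a) \<Rightarrow> 'a set"

definition reply :: "('k::wellorder, 'a) strategy \<Rightarrow> ('k \<Rightarrow> 'a set \<times> 'a) \<Rightarrow> 'k \<Rightarrow> 'a set" where
  "reply \<sigma> p \<alpha> = \<sigma> ((Some \<circ> p) |` {..\<alpha>})"

text \<open>In round \<open>0\<close> the intersection of all earlier replies is \<open>UNIV\<close>, so that the arena is \<open>X\<close>.\<close>

definition arena ::
    "'a topology \<Rightarrow> ('k::wellorder, 'a) strategy \<Rightarrow> ('k \<Rightarrow> 'a set \<times> 'a) \<Rightarrow> 'k \<Rightarrow> 'a topology" where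
  "arena X \<sigma> p \<alpha> = subtopology X (\<Inter>\<beta>\<in>{..<\<alpha>}. reply \<sigma> p \<beta>)"

definition legal_I ::
    "'a topology \<Rightarrow> ('k::wellorder, 'a) strategy \<Rightarrow> ('k \<Rightarrow> 'a set \<times> 'a) \<Rightarrow> 'k \<Rightarrow> bool" where
  "legal_I X \<sigma> p \<alpha> \<longleftrightarrow> openin (arena X \<sigma> p \<alpha>) (fst (p \<alpha>)) \<and> snd (p \<alpha>) \<in> fst (p \<alpha>)"

definition legal_II ::
    "'a topology \<Rightarrow> ('k::wellorder, 'a) strategy \<Rightarrow> ('k \<Rightarrow> 'a set \<times> 'a) \<Rightarrow> 'k \<Rightarrow> bool" where
  "legal_II X \<sigma> p \<alpha> \<longleftrightarrow>
     openin (arena X \<sigma> p \<alpha>) (reply \<sigma> p \<alpha>) \<and>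
     snd (p \<alpha>) \<in> reply \<sigma> p \<alpha> \<and> reply \<sigma> p \<alpha> \<subseteq> fst (p \<alpha>)"

text \<open>
  Limits \<open>\<gamma> < \<kappa>\<close> have to be treated separately from full plays: if the intersection at \<open>\<gamma>\<close>
  is empty then I has won, but cannot continue the play to length \<open>\<kappa>\<close>.
\<close>

definition winning_II :: "'a topology \<Rightarrow> ('k::wellorder, 'a) strategy \<Rightarrow> bool" where
  "winning_II X \<sigma> \<longleftrightarrow>
     (\<forall>p. (\<forall>\<alpha>. (\<forall>\<beta>\<le>\<alpha>. legal_I X \<sigma> p \<beta>) \<longrightarrow> legal_II X \<sigma> p \<alpha>) \<and>
          (\<forall>\<Gamma>\<in>limit_ordinals. (\<forall>\<alpha>\<in>\<Gamma>. legal_I X \<sigma> p \<alpha>) \<longrightarrow> (\<Inter>\<alpha>\<in>\<Gamma>. reply \<sigma> p \<alpha>) \<noteq> {}))"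

definition SC_space :: "'k::wellorder itself \<Rightarrow> 'a topology \<Rightarrow> bool" where
  "SC_space _ X \<longleftrightarrow>
     weight_le X (kappa :: 'k rel) \<and> (\<exists>\<sigma> :: ('k, 'a) strategy. winning_II X \<sigma>)"


subsection \<open>Metrics with values in an ordered group\<close>

definition coinitial_pos :: "'g::linordered_ab_group_add set \<Rightarrow> bool" where
  "coinitial_pos D \<longleftrightarrow> D \<subseteq> {0<..} \<and> (\<forall>\<epsilon>>0. \<exists>\<delta>\<in>D. \<delta> \<le> \<epsilon>)"

text \<open>\<open>Deg(\<bbbG>) = \<kappa>\<close>: the least size of a coinitial subset of the positive cone is \<open>\<kappa>\<close>.\<close>

definition has_Deg :: "'g::linordered_ab_group_add itself \<Rightarrow> 'k rel \<Rightarrow> bool" where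
  "has_Deg _ r \<longleftrightarrow>
     (\<exists>D :: 'g set. coinitial_pos D \<and> |D| =o r) \<and>
     (\<forall>D :: 'g set. coinitial_pos D \<longrightarrow> r \<le>o |D| )"

definition gmetric_on :: "'a set \<Rightarrow> ('a \<Rightarrow> 'a \<Rightarrow> 'g::linordered_ab_group_add) \<Rightarrow> bool" where
  "gmetric_on S d \<longleftrightarrow>
     (\<forall>x\<in>S. \<forall>y\<in>S. 0 \<le> d x y \<and> (d x y = 0 \<longleftrightarrow> x = y) \<and> d x y = d y x) \<and>
     (\<forall>x\<in>S. \<forall>y\<in>S. \<forall>z\<in>S. d x z \<le> d x y + d y z)"

definition gball :: "'a set \<Rightarrow> ('a \<Rightarrow> 'a \<Rightarrow> 'g::linordered_ab_group_add) \<Rightarrow> 'a \<Rightarrow> 'g \<Rightarrow> 'a set" where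
  "gball S d x \<epsilon> = {y\<in>S. d x y < \<epsilon>}"

definition gballs :: "'a set \<Rightarrow> ('a \<Rightarrow> 'a \<Rightarrow> 'g::linordered_ab_group_add) \<Rightarrow> 'a set set" where
  "gballs S d = {gball S d x \<epsilon> | x \<epsilon>. x \<in> S \<and> 0 < \<epsilon>}"

definition compatible :: "'a topology \<Rightarrow> ('a \<Rightarrow> 'a \<Rightarrow> 'g::linordered_ab_group_add) \<Rightarrow> bool" where
  "compatible X d \<longleftrightarrow>
     gmetric_on (topspace X) d \<and> X = topology_generated_by (gballs (topspace X) d)"

definition gCauchy ::
    "('a \<Rightarrow> 'a \<Rightarrow> 'g::linordered_ab_group_add) \<Rightarrow> ('k::wellorder \<Rightarrow> 'a) \<Rightarrow> bool" where
  "gCauchy d u \<longleftrightarrow> (\<forall>\<epsilon>>0. \<exists>\<alpha>. \<forall>\<beta>\<ge>\<alpha>. \<forall>\<gamma>\<ge>\<alpha>. d (u \<beta>) (u \<gamma>) < \<epsilon>)"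

definition Cauchy_complete ::
    "'k::wellorder itself \<Rightarrow> 'a set \<Rightarrow> ('a \<Rightarrow> 'a \<Rightarrow> 'g::linordered_ab_group_add) \<Rightarrow> bool" where
  "Cauchy_complete _ S d \<longleftrightarrow>
     (\<forall>u :: 'k \<Rightarrow> 'a. range u \<subseteq> S \<and> gCauchy d u \<longrightarrow>
        (\<exists>l. limitin (topology_generated_by (gballs S d)) u l at_top))"

text \<open>
  Decreasing sequences of balls are indexed by nonzero ordinals.  Those of order type less than
  \<open>\<kappa>\<close> are indexed by proper initial segments of \<open>'k\<close>.  For sequences of unrestricted order type,
  the index ordinals are represented by well-orders on sets of subsets of \<open>'a\<close>; this covers all
  order types because repetitions can be omitted from a sequence of subsets of \<open>'a\<close>, as
  \<open>spherically_complete_any_length\<close> confirms.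
\<close>

definition spherically_complete_below ::
    "'k::wellorder itself \<Rightarrow> 'a set \<Rightarrow> ('a \<Rightarrow> 'a \<Rightarrow> 'g::linordered_ab_group_add) \<Rightarrow> bool" where
  "spherically_complete_below _ S d \<longleftrightarrow>
     (\<forall>(\<alpha>::'k) B. {..<\<alpha>} \<noteq> {} \<and> (\<forall>\<beta><\<alpha>. B \<beta> \<in> gballs S d) \<and>
        (\<forall>\<gamma><\<alpha>. \<forall>\<beta>\<le>\<gamma>. B \<gamma> \<subseteq> B \<beta>) \<longrightarrow> (\<Inter>\<beta>\<in>{..<\<alpha>}. B \<beta>) \<noteq> {})"

definition spherically_complete ::
    "'a set \<Rightarrow> ('a \<Rightarrow> 'a \<Rightarrow> 'g::linordered_ab_group_add) \<Rightarrow> bool" where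
  "spherically_complete S d \<longleftrightarrow>
     (\<forall>(r :: 'a set rel) B. Well_order r \<and> Field r \<noteq> {} \<and> (\<forall>i\<in>Field r. B i \<in> gballs S d) \<and>
        (\<forall>(i, j)\<in>r. B j \<subseteq> B i) \<longrightarrow> (\<Inter>i\<in>Field r. B i) \<noteq> {})"

lemma spherically_complete_any_length:
  fixes r :: "'i rel" and B :: "'i \<Rightarrow> 'a set"
  assumes "spherically_complete S d" and wo: "Well_order r" and ne: "Field r \<noteq> {}"
    and balls: "\<forall>i\<in>Field r. B i \<in> gballs S d" and dec: "\<forall>(i, j)\<in>r. B j \<subseteq> B i"
  shows "(\<Inter>i\<in>Field r. B i) \<noteq> {}"
proof -
  define q where "q = {(M, N). M \<in> B ` Field r \<and> N \<in> B ` Field r \<and> N \<subseteq> M}"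
  have lin: "Linear_order r" and wf: "wf (r - Id)"
    using wo by (simp_all add: well_order_on_def)
  have F: "Field q = B ` Field r"
    by (auto simp: q_def Field_def)
  have comparable: "B i \<subseteq> B j \<or> B j \<subseteq> B i" if "i \<in> Field r" "j \<in> Field r" for i j
  proof (cases "i = j")
    case False
    with lin that have "(i, j) \<in> r \<or> (j, i) \<in> r"
      by (simp add: order_on_defs total_on_def)
    then show ?thesis using dec by blast
  qed simp
  have "q \<subseteq> Field q \<times> Field q"
    by (auto simp: Field_def)
  moreover have "refl_on (Field q) q"
    unfolding F by (auto simp: q_def refl_on_def)
  moreover have "trans q" "antisym q"
    by (auto simp: q_def trans_def antisym_def)
  moreover have "total_on (Field q) q"
    unfolding F total_on_def using comparable by (auto simp: q_def)
  ultimately have "Linear_order q"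
    by (simp add: order_on_defs)
  moreover have "wf (q - Id)"
  proof (rule wfI_min)
    fix M :: "'a set" and Q assume "M \<in> Q"
    show "\<exists>z\<in>Q. \<forall>y. (y, z) \<in> q - Id \<longrightarrow> y \<notin> Q"
    proof (cases "Q \<inter> B ` Field r = {}")
      case True
      then show ?thesis using \<open>M \<in> Q\<close> unfolding q_def by blast
    next
      case False
      then obtain i0 where i0: "i0 \<in> {i \<in> Field r. B i \<in> Q}" by blast
      obtain i where "i \<in> {i \<in> Field r. B i \<in> Q}"
        and min: "\<And>j. (j, i) \<in> r - Id \<Longrightarrow> j \<notin> {i \<in> Field r. B i \<in> Q}"
        by (rule wfE_min[OF wf i0]) (rule that)
      then have i: "i \<in> Field r" "B i \<in> Q" by simp_all
      have "B j \<subseteq> B i" if "j \<in> Field r" "B j \<in> Q" for j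
      proof (cases "i = j")
        case False
        with min[of j] that have "(j, i) \<notin> r" by blast
        with False lin that i have "(i, j) \<in> r"
          by (auto simp: order_on_defs total_on_def)
        then show ?thesis using dec by blast
      qed simp
      then have "\<forall>y. (y, B i) \<in> q - Id \<longrightarrow> y \<notin> Q"
        unfolding q_def by blast
      with i show ?thesis by blast
    qed
  qed
  ultimately have "Well_order q" by (simp add: well_order_on_def)
  moreover have "Field q \<noteq> {}" "\<forall>M\<in>Field q. M \<in> gballs S d" "\<forall>(M, N)\<in>q. N \<subseteq> M"
    using ne balls by (auto simp: F) (auto simp: q_def)
  ultimately have "(\<Inter>M\<in>Field q. M) \<noteq> {}"
    using assms(1) unfolding spherically_complete_def
    by (elim allE[where x = q] allE[where x = "\<lambda>M. M"]) blast
  then show ?thesis by (simp add: F)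
qed

definition G_Polish ::
    "'k::wellorder itself \<Rightarrow> 'g::linordered_ab_group_add itself \<Rightarrow> 'a topology \<Rightarrow> bool" where
  "G_Polish k _ X \<longleftrightarrow>
     weight_le X (kappa :: 'k rel) \<and>
     (\<exists>d :: 'a \<Rightarrow> 'a \<Rightarrow> 'g. compatible X d \<and> Cauchy_complete k (topspace X) d)"

definition spherically_complete_below_G_Polish ::
    "'k::wellorder itself \<Rightarrow> 'g::linordered_ab_group_add itself \<Rightarrow> 'a topology \<Rightarrow> bool" where
  "spherically_complete_below_G_Polish k g X \<longleftrightarrow>
     G_Polish k g X \<and>
     (\<exists>d :: 'a \<Rightarrow> 'a \<Rightarrow> 'g. compatible X d \<and> Cauchy_complete k (topspace X) d \<and>
        spherically_complete_below k (topspace X) d)"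

definition spherically_complete_G_Polish ::
    "'k::wellorder itself \<Rightarrow> 'g::linordered_ab_group_add itself \<Rightarrow> 'a topology \<Rightarrow> bool" where
  "spherically_complete_G_Polish k g X \<longleftrightarrow>
     G_Polish k g X \<and>
     (\<exists>d :: 'a \<Rightarrow> 'a \<Rightarrow> 'g. compatible X d \<and> Cauchy_complete k (topspace X) d \<and>
        spherically_complete (topspace X) d)"

end

theory Submission
  imports Defs
begin

text \<open>
  The proof goes around the cycle (a) \<open>\<Rightarrow>\<close> (e) \<open>\<Rightarrow>\<close> (d) \<open>\<Rightarrow>\<close> (c) \<open>\<Rightarrow>\<close> (b) \<open>\<Rightarrow>\<close> (a).

  Winning the strong Choquet game and being superclosed say the same thing about nested families
  of open sets: they have common points at every limit up to \<open>\<kappa>\<close>.  The notion \<open>branch_coding\<close> makes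
  this precise.  It is a coding of the points of \<open>X\<close> by elements of \<open>\<kappa>\<^sup>\<kappa>\<close> that is a homeomorphism onto
  its range and for which every sequence of limit length approximated by codes is realised by the
  code of a point.  Having one is equivalent to (e); for the direction from (e), a
  superclosed tree must be shown to have a branch through each node (\<open>superclosed_tree_branch\<close>).

  From (a) to a coding (\<open>additive_SC_imp_branch_coding\<close>).  A \<open>\<kappa>\<close>-additive regular space of weight at
  most \<open>\<kappa>\<close> has a clopen base of size at most \<open>\<kappa>\<close>, since \<open>\<kappa>\<close> is uncountable.  By additivity, any
  cover of an open set by at most \<open>\<kappa>\<close> clopen sets can be made disjoint while remaining open.  Using
  this, \<open>X\<close> is partitioned more and more finely in \<open>\<kappa>\<close> stages, such that each piece lies in an answer
  of player II to a move in which player I plays the intersection of the preceding pieces, and such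
  that the pieces of stage \<open>\<beta>\<close> are contained in or disjoint from the \<open>\<beta>\<close>-th basic set.  Nested pieces
  form plays, so II's strategy makes their intersections nonempty at all limits; full branches have
  at most one point, since the basic sets separate points.

  From a coding to (d) (\<open>branch_coding_imp_spherically_complete\<close>): the distance is given by the first
  difference of the codes, measured along a coinitial sequence of length \<open>\<kappa>\<close> in the positive cone.
  Balls are then cylinders, and both kinds of completeness are instances of completeness of the
  coding.  The weight is at most \<open>\<kappa>\<^sup><\<^sup>\<kappa> = \<kappa>\<close> (\<open>branch_coding_weight\<close>).

  From (c) to (b) (\<open>spherically_complete_below_imp_winning\<close>): player II plays small balls around the
  points played by I.  Spherical completeness takes care of limits below \<open>\<kappa>\<close> and Cauchy completeness
  of plays of length \<open>\<kappa>\<close>.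

  From (b) to (a) (\<open>compatible_imp_additive\<close>): fewer than \<open>\<kappa>\<close> positive elements of the group have a
  common positive lower bound.
\<close>

section \<open>The cardinal\<close>

lemma Field_kappa: "Field (kappa :: 'k::wellorder rel) = UNIV"
  by (auto simp: kappa_def Field_def)

lemma card_lessThan:
  assumes "admissible_cardinal TYPE('k::wellorder)"
  shows "|{..<\<alpha>::'k}| <o (kappa :: 'k rel)"
proof -
  have "underS (kappa :: 'k rel) \<alpha> = {..<\<alpha>}"
    by (auto simp: underS_def kappa_def)
  then show ?thesis
    using card_of_underS[of "kappa :: 'k rel" \<alpha>] assms
    by (simp add: admissible_cardinal_def Field_kappa)
qed

lemma kappa_card_UNIV:
  assumes "admissible_cardinal TYPE('k::wellorder)"
  shows "|UNIV :: 'k set| =o (kappa :: 'k rel)"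
  using assms card_of_Field_ordIso[of "kappa :: 'k rel"]
  by (simp add: admissible_cardinal_def Field_kappa)

lemma infinite_UNIV_kappa:
  assumes "admissible_cardinal TYPE('k::wellorder)"
  shows "infinite (UNIV :: 'k set)"
proof -
  have "natLeq \<le>o |UNIV :: 'k set|"
    using assms ordLess_ordIso_trans[OF _ ordIso_symmetric[OF kappa_card_UNIV[OF assms]]]
    by (auto simp: admissible_cardinal_def intro: ordLess_imp_ordLeq)
  then show ?thesis
    using infinite_iff_natLeq_ordLeq by blast
qed

lemma no_last_ordinal:
  assumes "admissible_cardinal TYPE('k::wellorder)"
  shows "\<exists>\<beta>::'k. \<alpha> < \<beta>"
proof -
  have "\<exists>\<beta>\<in>UNIV. \<alpha> \<noteq> \<beta> \<and> (\<alpha>, \<beta>) \<in> (kappa :: 'k rel)"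
    using infinite_Card_order_limit[of "kappa :: 'k rel" \<alpha>] assms infinite_UNIV_kappa[OF assms]
    by (simp add: admissible_cardinal_def Field_kappa)
  then show ?thesis by (auto simp: kappa_def order_less_le)
qed

lemma bounded_if_small:
  assumes "admissible_cardinal TYPE('k::wellorder)" and "|A| <o (kappa :: 'k rel)"
  shows "\<exists>\<beta>::'k. A \<subseteq> {..<\<beta>}"
proof -
  have "\<not> cofinal A (kappa :: 'k rel)"
    using assms not_ordLess_ordIso[of "|A|" "kappa :: 'k rel"]
    by (auto simp: admissible_cardinal_def regularCard_def Field_kappa)
  then obtain \<alpha> where \<alpha>: "\<forall>b\<in>A. b \<le> \<alpha>"
    unfolding cofinal_def Field_kappa by (auto simp: kappa_def) (metis linear)
  obtain \<beta> where "\<alpha> < \<beta>"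
    using no_last_ordinal[OF assms(1)] by blast
  with \<alpha> show ?thesis by (intro exI[of _ \<beta>]) auto
qed

text \<open>
  With \<open>2\<^sup><\<^sup>\<kappa> = \<kappa>\<close> also \<open>\<kappa>\<^sup><\<^sup>\<kappa> = \<kappa>\<close>: by regularity the graph of a short sequence, as a subset of
  \<open>\<kappa> \<times> \<kappa> \<cong> \<kappa>\<close>, is bounded, and a bounded subset of \<open>\<kappa>\<close> is a short binary sequence.
\<close>

lemma card_seqs:
  assumes adm: "admissible_cardinal TYPE('k::wellorder)"
  shows "|seqs :: ('k \<rightharpoonup> 'k) set| \<le>o (kappa :: 'k rel)"
proof -
  have "|UNIV \<times> UNIV :: ('k \<times> 'k) set| =o |UNIV :: 'k set|"
    by (rule card_of_Times_same_infinite[OF infinite_UNIV_kappa[OF adm]])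
  then obtain f :: "'k \<times> 'k \<Rightarrow> 'k" where f: "inj f"
    by (auto simp: card_of_ordIso[symmetric] bij_betw_def)
  define code where "code s = f ` Map.graph s" for s :: "'k \<rightharpoonup> 'k"
  have bounded: "\<exists>\<gamma>. code s \<subseteq> {..<\<gamma>}" if s: "s \<in> seqs" for s
  proof (rule bounded_if_small[OF adm])
    from s obtain \<alpha> where "dom s = {..<\<alpha>}" by (auto simp: seqs_def)
    moreover have "code s = (\<lambda>a. f (a, the (s a))) ` dom s"
      unfolding code_def image_def Map.graph_def by (auto simp: dom_def) force+
    ultimately have "|code s| \<le>o |{..<\<alpha>}|"
      by (simp add: card_of_image)
    then show "|code s| <o (kappa :: 'k rel)"
      using card_lessThan[OF adm] by (rule ordLeq_ordLess_trans)
  qed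
  (* A short binary sequence from which code s is recovered as the set of places with value True. *)
  define bin where "bin s = (\<lambda>\<beta>. Some (\<beta> \<in> code s)) |` {..<SOME \<gamma>. code s \<subseteq> {..<\<gamma>}}"
    for s :: "'k \<rightharpoonup> 'k"
  have code_bin: "code s = {\<beta>. bin s \<beta> = Some True}" if "s \<in> seqs" for s
    using someI_ex[OF bounded[OF that]] by (auto simp: bin_def restrict_map_def)
  have "inj_on bin seqs"
  proof (rule inj_onI)
    fix s t :: "'k \<rightharpoonup> 'k" assume "s \<in> seqs" "t \<in> seqs" "bin s = bin t"
    then have "code s = code t" by (simp add: code_bin)
    then have "Map.graph s = Map.graph t"
      unfolding code_def using inj_image_eq_iff[OF f] by blast
    then show "s = t"
      by (auto simp: fun_eq_iff Map.graph_def set_eq_iff) (metis option.exhaust)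
  qed
  moreover have "bin ` seqs \<subseteq> seqs"
    by (auto simp: bin_def seqs_def dom_def restrict_map_def)
  ultimately have "|seqs :: ('k \<rightharpoonup> 'k) set| \<le>o |seqs :: ('k \<rightharpoonup> bool) set|"
    unfolding card_of_ordLeq[symmetric] by blast
  moreover have "|seqs :: ('k \<rightharpoonup> bool) set| =o (kappa :: 'k rel)"
    using adm by (simp add: admissible_cardinal_def)
  ultimately show ?thesis by (rule ordLeq_ordIso_trans)
qed

lemma down_closed_ordinal:
  fixes \<Gamma> :: "'k::wellorder set"
  assumes "\<And>\<alpha> \<beta>. \<alpha> \<in> \<Gamma> \<Longrightarrow> \<beta> < \<alpha> \<Longrightarrow> \<beta> \<in> \<Gamma>"
  shows "\<Gamma> \<in> insert UNIV (range lessThan)"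
proof (cases "\<Gamma> = UNIV")
  case False
  define \<gamma> where "\<gamma> = (LEAST \<gamma>. \<gamma> \<notin> \<Gamma>)"
  have "\<gamma> \<notin> \<Gamma>"
    using False LeastI_ex[of "\<lambda>\<gamma>. \<gamma> \<notin> \<Gamma>"] by (auto simp: \<gamma>_def)
  moreover have "\<beta> \<in> \<Gamma>" if "\<beta> < \<gamma>" for \<beta>
    using not_less_Least[of \<beta> "\<lambda>\<gamma>. \<gamma> \<notin> \<Gamma>"] that by (auto simp: \<gamma>_def)
  ultimately have "\<Gamma> = {..<\<gamma>}"
    using assms by (auto simp: set_eq_iff) (metis linorder_neqE)
  then show ?thesis by simp
qed simp

lemma limit_ordinals_UNIV:
  assumes "admissible_cardinal TYPE('k::wellorder)"
  shows "(UNIV :: 'k set) \<in> limit_ordinals"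
  using no_last_ordinal[OF assms] by (auto simp: limit_ordinals_def)

lemma limit_ordinals_down:
  assumes "\<Gamma> \<in> limit_ordinals" "\<alpha> \<in> \<Gamma>" "\<beta> \<le> \<alpha>"
  shows "\<beta> \<in> \<Gamma>"
  using assms by (auto simp: limit_ordinals_def)

lemma additive_INT:
  fixes \<beta> :: "'k::wellorder"
  assumes adm: "admissible_cardinal TYPE('k)" and add: "additive_space (kappa :: 'k rel) X"
    and op: "\<And>\<gamma>. \<gamma> < \<beta> \<Longrightarrow> openin X (U \<gamma>)"
  shows "openin X {y \<in> topspace X. \<forall>\<gamma><\<beta>. y \<in> U \<gamma>}"
proof -
  have "|U ` {..<\<beta>}| <o (kappa :: 'k rel)"
    using card_of_image card_lessThan[OF adm] by (rule ordLeq_ordLess_trans)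
  then have "openin X (topspace X \<inter> \<Inter>(U ` {..<\<beta>}))"
    using add op by (auto simp: additive_space_def)
  also have "topspace X \<inter> \<Inter>(U ` {..<\<beta>}) = {y \<in> topspace X. \<forall>\<gamma><\<beta>. y \<in> U \<gamma>}"
    by auto
  finally show ?thesis .
qed

section \<open>Metrics with values in a group of degree \<open>\<kappa>\<close>\<close>

lemma small_set_positive_lower_bound:
  fixes A :: "'g::linordered_ab_group_add set"
  assumes deg: "has_Deg TYPE('g) r" and wo: "Well_order r" and "|A| <o r" and "A \<subseteq> {0<..}"
  shows "\<exists>\<epsilon>>0. \<forall>a\<in>A. \<epsilon> < a"
proof (rule ccontr)
  assume "\<not> ?thesis"
  then have "coinitial_pos A"
    using assms(4) by (auto simp: coinitial_pos_def) (meson not_less)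
  then have "r \<le>o |A|" using deg by (simp add: has_Deg_def)
  with assms(3) show False by (simp add: not_ordLess_ordLeq)
qed

text \<open>A strictly decreasing coinitial sequence of length \<open>\<kappa>\<close> in the positive cone: at stage \<open>\<alpha>\<close> go
  below all earlier values and below the \<open>\<alpha>\<close>-th element of a coinitial set of size \<open>\<kappa>\<close>.\<close>

lemma coinitial_sequence:
  assumes adm: "admissible_cardinal TYPE('k::wellorder)"
    and deg: "has_Deg TYPE('g::linordered_ab_group_add) (kappa :: 'k rel)"
  obtains \<epsilon> :: "'k::wellorder \<Rightarrow> 'g::linordered_ab_group_add" where "\<And>\<alpha>. 0 < \<epsilon> \<alpha>" "\<And>\<alpha> \<beta>. \<alpha> < \<beta> \<Longrightarrow> \<epsilon> \<beta> < \<epsilon> \<alpha>"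
    "\<And>r. 0 < r \<Longrightarrow> \<exists>\<alpha>. \<epsilon> \<alpha> < r"
proof -
  have wo: "Well_order (kappa :: 'k rel)"
    using adm by (simp add: admissible_cardinal_def card_order_on_well_order_on)
  obtain D :: "'g set" where D: "coinitial_pos D" "|D| =o (kappa :: 'k rel)"
    using deg by (auto simp: has_Deg_def)
  have "|UNIV :: 'k set| =o |D|"
    using kappa_card_UNIV[OF adm] D(2) ordIso_symmetric ordIso_transitive by blast
  then obtain h :: "'k \<Rightarrow> 'g" where h: "range h = D"
    by (auto simp: card_of_ordIso[symmetric] bij_betw_def)
  have "\<exists>\<epsilon>. \<forall>\<alpha>. 0 < \<epsilon> \<alpha> \<and> \<epsilon> \<alpha> \<le> h \<alpha> \<and> (\<forall>\<beta><\<alpha>. 0 < \<epsilon> \<beta> \<longrightarrow> \<epsilon> \<alpha> < \<epsilon> \<beta>)"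
  proof (rule dependent_wellorder_choice)
    fix \<alpha> :: 'k and f :: "'k \<Rightarrow> 'g"
    let ?A = "f ` {\<beta>. \<beta> < \<alpha> \<and> 0 < f \<beta>}"
    have "|?A| \<le>o |{..<\<alpha>}|"
      by (rule ordLeq_transitive[OF card_of_image card_of_mono1]) auto
    then have "|?A| <o (kappa :: 'k rel)"
      using card_lessThan[OF adm] by (rule ordLeq_ordLess_trans)
    then obtain \<delta> where \<delta>: "\<delta> > 0" "\<forall>a\<in>?A. \<delta> < a"
      using small_set_positive_lower_bound[OF deg wo, of ?A] by auto
    have "0 < h \<alpha>" using D(1) h by (auto simp: coinitial_pos_def)
    with \<delta> show "\<exists>r. 0 < r \<and> r \<le> h \<alpha> \<and> (\<forall>\<beta><\<alpha>. 0 < f \<beta> \<longrightarrow> r < f \<beta>)"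
      by (intro exI[of _ "min \<delta> (h \<alpha>)"]) (auto simp: min_less_iff_disj)
  qed auto
  then obtain \<epsilon> :: "'k \<Rightarrow> 'g" where
    \<epsilon>: "\<And>\<alpha>. 0 < \<epsilon> \<alpha>" "\<And>\<alpha>. \<epsilon> \<alpha> \<le> h \<alpha>" "\<And>\<alpha> \<beta>. \<beta> < \<alpha> \<Longrightarrow> \<epsilon> \<alpha> < \<epsilon> \<beta>" by blast
  have "\<exists>\<alpha>. \<epsilon> \<alpha> < r" if "0 < r" for r
  proof -
    obtain \<alpha> where "h \<alpha> \<le> r"
      using D(1) h \<open>0 < r\<close> unfolding coinitial_pos_def by blast
    moreover obtain \<beta> where "\<alpha> < \<beta>" using no_last_ordinal[OF adm] by blast
    ultimately show ?thesis
      using \<epsilon>(2)[of \<alpha>] \<epsilon>(3)[of \<alpha> \<beta>] by (intro exI[of _ \<beta>]) simp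
  qed
  with \<epsilon> that show thesis by blast
qed

lemma openin_gballs:
  fixes d :: "'a \<Rightarrow> 'a \<Rightarrow> 'g::linordered_ab_group_add"
  assumes gm: "gmetric_on S d" and pos: "\<exists>r::'g. 0 < r"
  shows "openin (topology_generated_by (gballs S d)) U \<longleftrightarrow>
           U \<subseteq> S \<and> (\<forall>x\<in>U. \<exists>r>0. gball S d x r \<subseteq> U)"
proof
  assume "openin (topology_generated_by (gballs S d)) U"
  then have "generate_topology_on (gballs S d) U"
    by (rule openin_topology_generated_by)
  then show "U \<subseteq> S \<and> (\<forall>x\<in>U. \<exists>r>0. gball S d x r \<subseteq> U)"
  proof induction
    case (Int a b)
    have "\<exists>r>0. gball S d x r \<subseteq> a \<inter> b" if "x \<in> a \<inter> b" for x
    proof -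
      from that Int obtain r s where "0 < r" "gball S d x r \<subseteq> a" "0 < s" "gball S d x s \<subseteq> b"
        by (metis Int_iff)
      then show ?thesis
        by (intro exI[of _ "min r s"]) (auto simp: gball_def)
    qed
    with Int show ?case by blast
  next
    case (UN K)
    then show ?case by (meson Sup_le_iff Union_iff subset_trans Union_upper)
  next
    case (Basis s)
    then obtain x r where s: "x \<in> S" "s = gball S d x r" by (auto simp: gballs_def)
    have "\<exists>q>0. gball S d y q \<subseteq> s" if y: "y \<in> s" for y
    proof (intro exI conjI)
      show "0 < r - d x y" using y by (simp add: s gball_def)
      show "gball S d y (r - d x y) \<subseteq> s"
      proof
        fix z assume z: "z \<in> gball S d y (r - d x y)"
        then have "d x z \<le> d x y + d y z"
          using gm s(1) y by (auto simp: gmetric_on_def s(2) gball_def)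
        with z show "z \<in> s" by (auto simp: s(2) gball_def less_diff_eq add.commute)
      qed
    qed
    then show ?case by (auto simp: s(2) gball_def)
  qed simp
next
  assume U: "U \<subseteq> S \<and> (\<forall>x\<in>U. \<exists>r>0. gball S d x r \<subseteq> U)"
  show "openin (topology_generated_by (gballs S d)) U"
  proof (subst openin_subopen, intro ballI)
    fix x assume x: "x \<in> U"
    with U obtain r where r: "r > 0" "gball S d x r \<subseteq> U" by blast
    have "gball S d x r \<in> gballs S d" using x U r by (auto simp: gballs_def)
    moreover have "x \<in> gball S d x r"
      using x U r(1) gm by (auto simp: gball_def gmetric_on_def) (metis subsetD)
    ultimately show "\<exists>T. openin (topology_generated_by (gballs S d)) T \<and> x \<in> T \<and> T \<subseteq> U"
      using r(2) topology_generated_by_Basis by blast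
  qed
qed

lemma has_Deg_pos:
  assumes "admissible_cardinal TYPE('k::wellorder)"
    and "has_Deg TYPE('g::linordered_ab_group_add) (kappa :: 'k rel)"
  shows "\<exists>r::'g. 0 < r"
  using coinitial_sequence[OF assms] by metis

lemma openin_compatible:
  assumes "admissible_cardinal TYPE('k::wellorder)"
    and "has_Deg TYPE('g::linordered_ab_group_add) (kappa :: 'k rel)"
    and "compatible X (d :: 'a \<Rightarrow> 'a \<Rightarrow> 'g)"
  shows "openin X U \<longleftrightarrow> U \<subseteq> topspace X \<and> (\<forall>x\<in>U. \<exists>r>0. gball (topspace X) d x r \<subseteq> U)"
proof -
  have "X = topology_generated_by (gballs (topspace X) d)" "gmetric_on (topspace X) d"
    using assms(3) by (auto simp: compatible_def)
  then show ?thesis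
    using openin_gballs[OF _ has_Deg_pos[OF assms(1,2)], of "topspace X" d U] by metis
qed

text \<open>The radii of fewer than \<open>\<kappa>\<close> balls around a point have a common positive lower bound, so the
  intersection of the balls contains a ball.\<close>

lemma compatible_imp_additive:
  assumes adm: "admissible_cardinal TYPE('k::wellorder)"
    and deg: "has_Deg TYPE('g::linordered_ab_group_add) (kappa :: 'k rel)"
    and comp: "compatible X (d :: 'a \<Rightarrow> 'a \<Rightarrow> 'g)"
  shows "additive_space (kappa :: 'k rel) X"
  unfolding additive_space_def
proof (intro allI impI, elim conjE)
  fix \<U> assume op: "\<forall>U\<in>\<U>. openin X U" and small: "|\<U>| <o (kappa :: 'k rel)"
  have wo: "Well_order (kappa :: 'k rel)"
    using adm by (simp add: admissible_cardinal_def card_order_on_well_order_on)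
  note open_iff = openin_compatible[OF adm deg comp]
  have "\<exists>r>0. gball (topspace X) d x r \<subseteq> topspace X \<inter> \<Inter>\<U>" if x: "x \<in> topspace X \<inter> \<Inter>\<U>" for x
  proof -
    have "\<forall>U\<in>\<U>. \<exists>r>0. gball (topspace X) d x r \<subseteq> U"
      using op x open_iff by auto
    then obtain r where r: "\<And>U. U \<in> \<U> \<Longrightarrow> 0 < r U \<and> gball (topspace X) d x (r U) \<subseteq> U"
      by metis
    have "|r ` \<U>| <o (kappa :: 'k rel)"
      using card_of_image small by (rule ordLeq_ordLess_trans)
    then obtain \<epsilon> where "\<epsilon> > 0" "\<forall>a\<in>r ` \<U>. \<epsilon> < a"
      using small_set_positive_lower_bound[OF deg wo, of "r ` \<U>"] r by auto
    then have "gball (topspace X) d x \<epsilon> \<subseteq> topspace X \<inter> \<Inter>\<U>"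
      using r by (fastforce simp: gball_def)
    with \<open>\<epsilon> > 0\<close> show ?thesis by blast
  qed
  then show "openin X (topspace X \<inter> \<Inter>\<U>)"
    unfolding open_iff by blast
qed

section \<open>Branch codings\<close>

lemma dom_Some_comp [simp]: "dom (Some \<circ> f) = UNIV"
  by auto

definition cylinder :: "'a topology \<Rightarrow> ('a \<Rightarrow> 'k::wellorder \<Rightarrow> 'k) \<Rightarrow> 'a \<Rightarrow> 'k \<Rightarrow> 'a set" where
  "cylinder X e x \<alpha> = {y \<in> topspace X. \<forall>\<beta><\<alpha>. e y \<beta> = e x \<beta>}"

text \<open>
  Such an \<open>e\<close> is a homeomorphism from \<open>X\<close> onto a superclosed subset of \<open>\<kappa>\<^sup>\<kappa>\<close>.  The last clause is
  the closure of the tree of initial segments of the range under limits of length at most \<open>\<kappa>\<close>: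
  a sequence whose proper initial segments are realised by points of \<open>X\<close> is realised itself.
  With points in place of nodes, limits below \<open>\<kappa>\<close> and the limit \<open>\<kappa>\<close> itself are treated alike, as
  they are in the game.
\<close>

definition branch_coding :: "'a topology \<Rightarrow> ('a \<Rightarrow> 'k::wellorder \<Rightarrow> 'k) \<Rightarrow> bool" where
  "branch_coding X e \<longleftrightarrow>
     inj_on e (topspace X) \<and>
     (\<forall>U. openin X U \<longleftrightarrow> U \<subseteq> topspace X \<and> (\<forall>x\<in>U. \<exists>\<alpha>. cylinder X e x \<alpha> \<subseteq> U)) \<and>
     (\<forall>\<Gamma>\<in>limit_ordinals. \<forall>z. (\<forall>\<alpha>\<in>\<Gamma>. \<exists>x\<in>topspace X. \<forall>\<beta><\<alpha>. e x \<beta> = z \<beta>) \<longrightarrow>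
        (\<exists>y\<in>topspace X. \<forall>\<beta>\<in>\<Gamma>. e y \<beta> = z \<beta>))"

lemma branch_coding_inj:
  "branch_coding X e \<Longrightarrow> inj_on e (topspace X)"
  by (simp add: branch_coding_def)

lemma branch_coding_open:
  "branch_coding X e \<Longrightarrow> openin X U \<longleftrightarrow> U \<subseteq> topspace X \<and> (\<forall>x\<in>U. \<exists>\<alpha>. cylinder X e x \<alpha> \<subseteq> U)"
  by (simp add: branch_coding_def)

lemma branch_coding_complete:
  assumes "branch_coding X e" "\<Gamma> \<in> limit_ordinals"
    and "\<And>\<alpha>. \<alpha> \<in> \<Gamma> \<Longrightarrow> \<exists>x\<in>topspace X. \<forall>\<beta><\<alpha>. e x \<beta> = z \<beta>"
  obtains y where "y \<in> topspace X" "\<And>\<beta>. \<beta> \<in> \<Gamma> \<Longrightarrow> e y \<beta> = z \<beta>"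
proof -
  have "\<exists>y\<in>topspace X. \<forall>\<beta>\<in>\<Gamma>. e y \<beta> = z \<beta>"
    using assms by (simp add: branch_coding_def)
  with that show thesis by blast
qed

lemma openin_cylinder:
  assumes "branch_coding X e"
  shows "openin X (cylinder X e x \<alpha>)"
proof -
  have "cylinder X e y \<alpha> \<subseteq> cylinder X e x \<alpha>" if "y \<in> cylinder X e x \<alpha>" for y
    using that by (auto simp: cylinder_def)
  moreover have "cylinder X e x \<alpha> \<subseteq> topspace X"
    by (auto simp: cylinder_def)
  ultimately show ?thesis
    unfolding branch_coding_open[OF assms] by blast
qed

text \<open>A cylinder is determined by a sequence of length less than \<open>\<kappa>\<close>, and \<open>\<kappa>\<^sup><\<^sup>\<kappa> = \<kappa>\<close>.\<close>

lemma branch_coding_weight: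
  fixes e :: "'a \<Rightarrow> 'k::wellorder \<Rightarrow> 'k"
  assumes adm: "admissible_cardinal TYPE('k)" and cod: "branch_coding X e"
  shows "weight_le X (kappa :: 'k rel)"
proof -
  define \<B> where "\<B> = {cylinder X e x \<alpha> | x \<alpha>. True}"
  define h where "h s = {y \<in> topspace X. s \<subseteq>\<^sub>m Some \<circ> e y}" for s :: "'k \<rightharpoonup> 'k"
  have "cylinder X e x \<alpha> \<in> h ` seqs" for x \<alpha>
  proof
    show "(Some \<circ> e x) |` {..<\<alpha>} \<in> seqs" by (auto simp: seqs_def)
    show "cylinder X e x \<alpha> = h ((Some \<circ> e x) |` {..<\<alpha>})"
      by (auto simp: h_def cylinder_def map_le_def)
  qed
  then have "\<B> \<subseteq> h ` seqs" by (auto simp: \<B>_def)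
  then have "|\<B>| \<le>o |seqs :: ('k \<rightharpoonup> 'k) set|"
    by (rule ordLeq_transitive[OF card_of_mono1 card_of_image])
  then have "|\<B>| \<le>o (kappa :: 'k rel)"
    using card_seqs[OF adm] by (rule ordLeq_transitive)
  moreover have "\<forall>V\<in>\<B>. openin X V"
    using openin_cylinder[OF cod] by (auto simp: \<B>_def)
  moreover have "\<exists>V\<in>\<B>. x \<in> V \<and> V \<subseteq> U" if "openin X U" "x \<in> U" for U x
  proof -
    from that obtain \<alpha> where "x \<in> topspace X" "cylinder X e x \<alpha> \<subseteq> U"
      unfolding branch_coding_open[OF cod] by blast
    then show ?thesis by (auto simp: \<B>_def cylinder_def)
  qed
  ultimately show ?thesis unfolding weight_le_def by blast
qed

section \<open>Superclosed sets\<close>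

lemma openin_bounded_topology:
  "openin bounded_topology U \<longleftrightarrow> (\<forall>x\<in>U. \<exists>\<alpha>. {y. \<forall>\<beta><\<alpha>. y \<beta> = x \<beta>} \<subseteq> U)"
    (is "_ \<longleftrightarrow> ?open U")
proof
  assume "openin bounded_topology U"
  then have "generate_topology_on {{x. s \<subseteq>\<^sub>m Some \<circ> x} | s. s \<in> seqs} U"
    unfolding bounded_topology_def by (rule openin_topology_generated_by)
  then show "?open U"
  proof induction
    case (Int a b)
    have "\<exists>\<alpha>. {y. \<forall>\<beta><\<alpha>. y \<beta> = x \<beta>} \<subseteq> a \<inter> b" if x: "x \<in> a \<inter> b" for x
    proof -
      obtain \<alpha> \<beta> where "{y. \<forall>\<gamma><\<alpha>. y \<gamma> = x \<gamma>} \<subseteq> a" "{y. \<forall>\<gamma><\<beta>. y \<gamma> = x \<gamma>} \<subseteq> b"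
        using Int x by blast
      then show ?thesis by (intro exI[of _ "max \<alpha> \<beta>"]) (auto simp: less_max_iff_disj)
    qed
    then show ?case by blast
  next
    case (UN K)
    then show ?case by (meson Union_iff Union_upper subset_trans)
  next
    case (Basis B)
    then obtain s \<alpha> where "B = {x. s \<subseteq>\<^sub>m Some \<circ> x}" "dom s = {..<\<alpha>}"
      by (auto simp: seqs_def)
    then show ?case by (auto simp: map_le_def intro!: exI[of _ \<alpha>])
  qed simp
next
  assume U: "?open U"
  show "openin bounded_topology U"
  proof (subst openin_subopen, intro ballI)
    fix x assume "x \<in> U"
    with U obtain \<alpha> where \<alpha>: "{y. \<forall>\<beta><\<alpha>. y \<beta> = x \<beta>} \<subseteq> U" by blast
    let ?s = "(Some \<circ> x) |` {..<\<alpha>}"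
    have "?s \<in> seqs" by (auto simp: seqs_def)
    then have "openin bounded_topology {y. ?s \<subseteq>\<^sub>m Some \<circ> y}"
      unfolding bounded_topology_def by (intro topology_generated_by_Basis) blast
    moreover have "{y. ?s \<subseteq>\<^sub>m Some \<circ> y} = {y. \<forall>\<beta><\<alpha>. y \<beta> = x \<beta>}"
      by (auto simp: map_le_def)
    ultimately show "\<exists>V. openin bounded_topology V \<and> x \<in> V \<and> V \<subseteq> U"
      using \<alpha> by auto
  qed
qed

lemma topspace_bounded_topology: "topspace bounded_topology = UNIV"
  using openin_bounded_topology[of UNIV] openin_subset by fastforce

text \<open>The bounded topology on the range of \<open>e\<close> corresponds to the topology on \<open>X\<close> in which cylinders are
  the basic neighbourhoods.\<close>

lemma openin_image_bounded_topology:
  assumes inj: "inj_on e (topspace X)" and U: "U \<subseteq> topspace X"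
  shows "openin (subtopology bounded_topology (e ` topspace X)) (e ` U) \<longleftrightarrow>
           (\<forall>x\<in>U. \<exists>\<alpha>. cylinder X e x \<alpha> \<subseteq> U)"
proof
  assume "openin (subtopology bounded_topology (e ` topspace X)) (e ` U)"
  then obtain V where V: "openin bounded_topology V" "e ` U = V \<inter> e ` topspace X"
    by (auto simp: openin_subtopology)
  show "\<forall>x\<in>U. \<exists>\<alpha>. cylinder X e x \<alpha> \<subseteq> U"
  proof
    fix x assume "x \<in> U"
    with V obtain \<alpha> where \<alpha>: "{y. \<forall>\<beta><\<alpha>. y \<beta> = e x \<beta>} \<subseteq> V"
      unfolding openin_bounded_topology by blast
    have "y \<in> U" if "y \<in> cylinder X e x \<alpha>" for y
    proof -
      from that \<alpha> have y: "y \<in> topspace X" "e y \<in> V \<inter> e ` topspace X"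
        by (auto simp: cylinder_def)
      with V(2) have "e y \<in> e ` U" by simp
      then show ?thesis using inj_on_image_mem_iff[OF inj y(1) U] by simp
    qed
    then show "\<exists>\<alpha>. cylinder X e x \<alpha> \<subseteq> U" by blast
  qed
next
  assume cyl: "\<forall>x\<in>U. \<exists>\<alpha>. cylinder X e x \<alpha> \<subseteq> U"
  define V where "V = {z. \<exists>\<alpha>. \<exists>x\<in>U. cylinder X e x \<alpha> \<subseteq> U \<and> (\<forall>\<beta><\<alpha>. z \<beta> = e x \<beta>)}"
  have "openin bounded_topology V"
    unfolding openin_bounded_topology
  proof
    fix z assume "z \<in> V"
    then obtain \<alpha> x where x: "x \<in> U" "cylinder X e x \<alpha> \<subseteq> U" "\<forall>\<beta><\<alpha>. z \<beta> = e x \<beta>"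
      by (auto simp: V_def)
    have "y \<in> V" if "\<forall>\<beta><\<alpha>. y \<beta> = z \<beta>" for y
    proof -
      from that x(3) have "\<forall>\<beta><\<alpha>. y \<beta> = e x \<beta>" by simp
      with x(1,2) show ?thesis unfolding V_def by blast
    qed
    then show "\<exists>\<alpha>. {y. \<forall>\<beta><\<alpha>. y \<beta> = z \<beta>} \<subseteq> V" by blast
  qed
  moreover have "e ` U = V \<inter> e ` topspace X"
  proof
    have "e x \<in> V" if "x \<in> U" for x
      using cyl that unfolding V_def by blast
    then show "e ` U \<subseteq> V \<inter> e ` topspace X" using U by blast
    show "V \<inter> e ` topspace X \<subseteq> e ` U"
    proof
      fix z assume "z \<in> V \<inter> e ` topspace X"
      then obtain \<alpha> x y where "cylinder X e x \<alpha> \<subseteq> U" "\<forall>\<beta><\<alpha>. z \<beta> = e x \<beta>"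
        "y \<in> topspace X" "z = e y"
        by (auto simp: V_def)
      moreover from this have "y \<in> cylinder X e x \<alpha>" by (simp add: cylinder_def)
      ultimately show "z \<in> e ` U" by blast
    qed
  qed
  ultimately show "openin (subtopology bounded_topology (e ` topspace X)) (e ` U)"
    by (auto simp: openin_subtopology)
qed

lemma closedin_body: "closedin bounded_topology (body T)"
proof -
  have "openin bounded_topology (- body T)"
    unfolding openin_bounded_topology
  proof
    fix x assume "x \<in> - body T"
    then obtain \<alpha> where \<alpha>: "(Some \<circ> x) |` {..<\<alpha>} \<notin> T" by (auto simp: body_def)
    have "y \<notin> body T" if "\<forall>\<beta><\<alpha>. y \<beta> = x \<beta>" for y
    proof -
      have "(Some \<circ> y) |` {..<\<alpha>} = (Some \<circ> x) |` {..<\<alpha>}"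
        using that by (auto simp: restrict_map_def)
      with \<alpha> show ?thesis unfolding body_def by (metis (mono_tags) mem_Collect_eq)
    qed
    then show "\<exists>\<alpha>. {y. \<forall>\<beta><\<alpha>. y \<beta> = x \<beta>} \<subseteq> - body T" by blast
  qed
  then show ?thesis by (simp add: closedin_def topspace_bounded_topology flip: Compl_eq_Diff_UNIV)
qed

text \<open>Being pruned only gives extensions of length less than \<open>\<kappa>\<close>; a cofinal branch is built by
  recursion, successor steps using prunedness and limit steps \<open><\<kappa>\<close>-closure.\<close>

lemma superclosed_tree_branch:
  fixes T :: "('k::wellorder \<rightharpoonup> 'k) set"
  assumes adm: "admissible_cardinal TYPE('k)" and T: "superclosed_tree T" and s: "s \<in> T"
  obtains x where "x \<in> body T" "s \<subseteq>\<^sub>m Some \<circ> x"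
proof -
  define P where "P f \<alpha> v \<longleftrightarrow>
    (if \<alpha> \<in> dom s then s \<alpha> = Some v
     else (Some \<circ> f) |` {..<\<alpha>} \<in> T \<longrightarrow> ((Some \<circ> f) |` {..<\<alpha>})(\<alpha> \<mapsto> v) \<in> T)"
    for f :: "'k \<Rightarrow> 'k" and \<alpha> v
  have "\<exists>x. \<forall>\<alpha>. P x \<alpha> (x \<alpha>)"
  proof (rule dependent_wellorder_choice)
    fix r \<alpha> and f g :: "'k \<Rightarrow> 'k" assume "\<And>\<beta>. \<beta> < \<alpha> \<Longrightarrow> f \<beta> = g \<beta>"
    then have "(Some \<circ> f) |` {..<\<alpha>} = (Some \<circ> g) |` {..<\<alpha>}"
      by (auto simp: restrict_map_def)
    then show "P f \<alpha> r = P g \<alpha> r" by (simp add: P_def)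
  next
    fix \<alpha> and f :: "'k \<Rightarrow> 'k"
    show "\<exists>r. P f \<alpha> r"
    proof (cases "\<alpha> \<in> dom s \<or> (Some \<circ> f) |` {..<\<alpha>} \<notin> T")
      case True
      then show ?thesis by (auto simp: P_def)
    next
      case False
      let ?t = "(Some \<circ> f) |` {..<\<alpha>}"
      obtain \<alpha>' where "\<alpha> < \<alpha>'" using no_last_ordinal[OF adm] by blast
      moreover have "dom ?t \<subseteq> {..<\<alpha>'}" using \<open>\<alpha> < \<alpha>'\<close> by auto
      ultimately obtain t where t: "t \<in> T" "?t \<subseteq>\<^sub>m t" "dom t = {..<\<alpha>'}"
        using T False unfolding superclosed_tree_def pruned_def by blast
      obtain v where v: "t \<alpha> = Some v" using t(3) \<open>\<alpha> < \<alpha>'\<close> by blast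
      have "t |` {..\<alpha>} = ?t(\<alpha> \<mapsto> v)"
      proof
        fix \<beta>
        have "t \<beta> = Some (f \<beta>)" if "\<beta> < \<alpha>"
          using bspec[OF t(2)[unfolded map_le_def], of \<beta>] that by simp
        then show "(t |` {..\<alpha>}) \<beta> = (?t(\<alpha> \<mapsto> v)) \<beta>"
          using v by (cases \<beta> \<alpha> rule: linorder_cases) (auto simp: restrict_map_def)
      qed
      moreover have "t |` {..\<alpha>} \<in> T"
      proof -
        define \<gamma> where "\<gamma> = (LEAST \<gamma>. \<alpha> < \<gamma>)"
        have "{..\<alpha>} = {..<\<gamma>}"
          using LeastI[of "\<lambda>\<gamma>. \<alpha> < \<gamma>", OF \<open>\<alpha> < \<alpha>'\<close>] Least_le[of "\<lambda>\<gamma>. \<alpha> < \<gamma>"]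
          unfolding \<gamma>_def by (auto simp: not_less) (metis not_less)
        then show ?thesis using T t(1) by (simp add: superclosed_tree_def is_tree_def)
      qed
      ultimately show ?thesis using False by (auto simp: P_def)
    qed
  qed
  then obtain x where x: "\<And>\<alpha>. P x \<alpha> (x \<alpha>)" by blast
  have sx: "s \<subseteq>\<^sub>m Some \<circ> x"
  proof -
    have "s \<alpha> = Some (x \<alpha>)" if "\<alpha> \<in> dom s" for \<alpha>
      using x[of \<alpha>] that by (simp add: P_def)
    then show ?thesis by (simp add: map_le_def)
  qed
  have "(Some \<circ> x) |` {..<\<alpha>} \<in> T" for \<alpha>
  proof (induction \<alpha> rule: less_induct)
    case (less \<alpha>)
    show ?case
    proof (cases "{..<\<alpha>} \<subseteq> dom s")
      case True
      then have "(Some \<circ> x) |` {..<\<alpha>} = s |` {..<\<alpha>}"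
        using sx by (auto simp: restrict_map_def map_le_def fun_eq_iff subset_iff)
      then show ?thesis
        using T s unfolding superclosed_tree_def is_tree_def by metis
    next
      case False
      then obtain \<delta> where \<delta>: "\<delta> < \<alpha>" "\<delta> \<notin> dom s" by blast
      show ?thesis
      proof (cases "\<forall>\<beta><\<alpha>. \<exists>\<gamma><\<alpha>. \<beta> < \<gamma>")
        case True
        with \<delta> have "{..<\<alpha>} \<in> limit_ordinals" by (auto simp: limit_ordinals_def)
        moreover have "((Some \<circ> x) |` {..<\<alpha>}) |` {..<\<beta>} \<in> T" if "\<beta> < \<alpha>" for \<beta>
        proof -
          have eq: "((Some \<circ> x) |` {..<\<alpha>}) |` {..<\<beta>} = (Some \<circ> x) |` {..<\<beta>}"
            using that by (auto simp: restrict_map_def fun_eq_iff)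
          show ?thesis unfolding eq by (rule less[OF that])
        qed
        moreover have "dom ((Some \<circ> x) |` {..<\<alpha>}) = {..<\<alpha>}" by simp
        ultimately show ?thesis
          using T unfolding superclosed_tree_def closed_below_def by blast
      next
        case False
        then obtain \<beta> where \<beta>: "\<beta> < \<alpha>" "\<forall>\<gamma><\<alpha>. \<gamma> \<le> \<beta>" by (meson not_less)
        obtain l where "dom s = {..<l}"
          using T s by (auto simp: superclosed_tree_def is_tree_def seqs_def)
        with \<beta>(2) \<delta> have "\<beta> \<notin> dom s" by auto
        then have "((Some \<circ> x) |` {..<\<beta>})(\<beta> \<mapsto> x \<beta>) \<in> T"
          using x[of \<beta>] less[OF \<beta>(1)] by (simp add: P_def)
        moreover have "((Some \<circ> x) |` {..<\<beta>})(\<beta> \<mapsto> x \<beta>) = (Some \<circ> x) |` {..<\<alpha>}"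
          using \<beta> by (auto simp: restrict_map_def fun_eq_iff order_less_le)
        ultimately show ?thesis by (simp only:)
      qed
    qed
  qed
  then have "x \<in> body T" by (simp add: body_def)
  with sx that show thesis by blast
qed

text \<open>
  A sequence approximated by points of \<open>C = [T]\<close> has all its proper initial segments in \<open>T\<close>.  If its
  length is \<open>\<kappa>\<close> it is a branch of \<open>T\<close>; otherwise it is a node by \<open><\<kappa>\<close>-closure, and some branch passes
  through it.
\<close>

lemma homeomorphic_superclosed_imp_branch_coding:
  fixes C :: "('k::wellorder \<Rightarrow> 'k) set"
  assumes adm: "admissible_cardinal TYPE('k)" and C: "superclosed C"
    and hom: "X homeomorphic_space subtopology bounded_topology C"
  shows "\<exists>e :: 'a \<Rightarrow> 'k \<Rightarrow> 'k. branch_coding X e"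
proof -
  obtain e where e: "homeomorphic_map X (subtopology bounded_topology C) e"
    using hom by (auto simp: homeomorphic_space)
  have inj: "inj_on e (topspace X)" and im: "e ` topspace X = C"
    using e by (auto simp: homeomorphic_eq_everything_map topspace_bounded_topology)
  have "openin X U \<longleftrightarrow> U \<subseteq> topspace X \<and> (\<forall>x\<in>U. \<exists>\<alpha>. cylinder X e x \<alpha> \<subseteq> U)" for U
  proof (cases "U \<subseteq> topspace X")
    case True
    then have "openin X U \<longleftrightarrow> openin (subtopology bounded_topology C) (e ` U)"
      using homeomorphic_map_openness[OF e] by simp
    also have "\<dots> \<longleftrightarrow> (\<forall>x\<in>U. \<exists>\<alpha>. cylinder X e x \<alpha> \<subseteq> U)"
      using openin_image_bounded_topology[OF inj True] im by simp
    finally show ?thesis using True by simp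
  qed (auto dest: openin_subset)
  moreover have "\<exists>y\<in>topspace X. \<forall>\<beta>\<in>\<Gamma>. e y \<beta> = z \<beta>"
    if \<Gamma>: "\<Gamma> \<in> limit_ordinals" and approx: "\<forall>\<alpha>\<in>\<Gamma>. \<exists>x\<in>topspace X. \<forall>\<beta><\<alpha>. e x \<beta> = z \<beta>" for \<Gamma> z
  proof -
    obtain T where T: "superclosed_tree T" "C = body T"
      using C by (auto simp: superclosed_def)
    have zT: "(Some \<circ> z) |` {..<\<alpha>} \<in> T" if "\<alpha> \<in> \<Gamma>" for \<alpha>
    proof -
      from approx that obtain x where x: "x \<in> topspace X" "\<forall>\<beta><\<alpha>. e x \<beta> = z \<beta>" by blast
      then have "(Some \<circ> z) |` {..<\<alpha>} = (Some \<circ> e x) |` {..<\<alpha>}"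
        by (auto simp: restrict_map_def)
      moreover have "e x \<in> body T" using x(1) im T(2) by blast
      ultimately show ?thesis by (simp add: body_def)
    qed
    show ?thesis
    proof (cases "\<Gamma> = UNIV")
      case True
      with zT have "z \<in> e ` topspace X" by (simp add: im T(2) body_def)
      then show ?thesis by blast
    next
      case False
      with \<Gamma> obtain \<gamma> where \<gamma>: "\<Gamma> = {..<\<gamma>}" by (auto simp: limit_ordinals_def)
      let ?s = "(Some \<circ> z) |` {..<\<gamma>}"
      have "?s |` {..<\<alpha>} \<in> T" if "\<alpha> < \<gamma>" for \<alpha>
      proof -
        have "{..<\<gamma>} \<inter> {..<\<alpha>} = {..<\<alpha>}" using that by auto
        with zT that \<gamma> show ?thesis by simp
      qed
      moreover have "dom ?s = {..<\<gamma>}" by auto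
      ultimately have "?s \<in> T"
        using T(1) \<Gamma> \<gamma> unfolding superclosed_tree_def closed_below_def by blast
      then obtain y where "y \<in> C" "?s \<subseteq>\<^sub>m Some \<circ> y"
        using superclosed_tree_branch[OF adm T(1)] T(2) by metis
      moreover from this have "\<forall>\<beta>\<in>\<Gamma>. y \<beta> = z \<beta>"
        by (auto simp: \<gamma> map_le_def)
      ultimately show ?thesis using im by blast
    qed
  qed
  ultimately have "branch_coding X e" using inj by (simp add: branch_coding_def)
  then show ?thesis by blast
qed

text \<open>The tree of initial segments of the range is pruned because each of its nodes lies on the branch
  given by a point of \<open>X\<close>.\<close>

lemma branch_coding_imp_homeomorphic_superclosed:
  fixes e :: "'a \<Rightarrow> 'k::wellorder \<Rightarrow> 'k"
  assumes adm: "admissible_cardinal TYPE('k)" and cod: "branch_coding X e"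
  shows "\<exists>C :: ('k \<Rightarrow> 'k) set. superclosed C \<and> X homeomorphic_space subtopology bounded_topology C"
proof -
  define T where "T = {(Some \<circ> e x) |` {..<\<alpha>} | x \<alpha>. x \<in> topspace X}"
  have restr_T: "\<exists>x\<in>topspace X. \<forall>\<beta>\<in>{..<\<alpha>} \<inter> dom s. s \<beta> = Some (e x \<beta>)"
    if "s |` {..<\<alpha>} \<in> T" for s \<alpha>
  proof -
    from that obtain x \<alpha>' where x: "x \<in> topspace X" "s |` {..<\<alpha>} = (Some \<circ> e x) |` {..<\<alpha>'}"
      by (auto simp: T_def)
    have "s \<beta> = Some (e x \<beta>)" if "\<beta> \<in> {..<\<alpha>} \<inter> dom s" for \<beta>
      using fun_cong[OF x(2), of \<beta>] that by (auto simp: restrict_map_def split: if_splits)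
    with x(1) show ?thesis by blast
  qed
  have "is_tree T"
    unfolding is_tree_def
  proof (intro conjI ballI allI)
    show "T \<subseteq> seqs" by (auto simp: T_def seqs_def)
    fix s \<alpha> assume "s \<in> T"
    then obtain x \<alpha>' where "x \<in> topspace X" "s = (Some \<circ> e x) |` {..<\<alpha>'}" by (auto simp: T_def)
    moreover have "{..<\<alpha>'} \<inter> {..<\<alpha>} = {..<min \<alpha>' \<alpha>}" by auto
    ultimately show "s |` {..<\<alpha>} \<in> T" by (auto simp: T_def)
  qed
  moreover have "pruned T"
    unfolding pruned_def
  proof (intro ballI allI impI)
    fix s \<alpha> assume "s \<in> T" and dom: "dom s \<subseteq> {..<\<alpha>}"
    then obtain x \<alpha>' where x: "x \<in> topspace X" "s = (Some \<circ> e x) |` {..<\<alpha>'}" by (auto simp: T_def)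
    have "(Some \<circ> e x) |` {..<\<alpha>} \<in> T" using x by (auto simp: T_def)
    moreover have "s \<subseteq>\<^sub>m (Some \<circ> e x) |` {..<\<alpha>}"
      using dom x(2) by (auto simp: map_le_def restrict_map_def)
    moreover have "dom ((Some \<circ> e x) |` {..<\<alpha>}) = {..<\<alpha>}" by auto
    ultimately show "\<exists>t\<in>T. s \<subseteq>\<^sub>m t \<and> dom t = {..<\<alpha>}" by blast
  qed
  moreover have "closed_below T"
    unfolding closed_below_def
  proof (intro allI impI, elim conjE)
    fix \<gamma> s assume lim: "{..<\<gamma>} \<in> limit_ordinals" and dom: "dom s = {..<\<gamma>}"
      and T: "\<forall>\<alpha><\<gamma>. s |` {..<\<alpha>} \<in> T"
    have "\<exists>x\<in>topspace X. \<forall>\<beta><\<alpha>. e x \<beta> = the (s \<beta>)" if "\<alpha> \<in> {..<\<gamma>}" for \<alpha>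
    proof -
      have "s |` {..<\<alpha>} \<in> T" using T that by simp
      then obtain x where "x \<in> topspace X" "\<forall>\<beta>\<in>{..<\<alpha>} \<inter> dom s. s \<beta> = Some (e x \<beta>)"
        using restr_T by blast
      with that dom show ?thesis by (intro bexI[of _ x]) auto
    qed
    then obtain y where y: "y \<in> topspace X" "\<And>\<beta>. \<beta> \<in> {..<\<gamma>} \<Longrightarrow> e y \<beta> = the (s \<beta>)"
      using branch_coding_complete[OF cod lim, of "\<lambda>\<beta>. the (s \<beta>)"] by metis
    have "s = (Some \<circ> e y) |` {..<\<gamma>}"
    proof
      fix \<beta> show "s \<beta> = ((Some \<circ> e y) |` {..<\<gamma>}) \<beta>"
        using y(2)[of \<beta>] dom by (cases "\<beta> < \<gamma>") (auto simp: restrict_map_def dom_def set_eq_iff)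
    qed
    with y(1) show "s \<in> T" by (auto simp: T_def)
  qed
  ultimately have T: "superclosed_tree T" by (simp add: superclosed_tree_def)
  have body: "body T = e ` topspace X"
  proof
    show "e ` topspace X \<subseteq> body T" by (auto simp: body_def T_def)
    show "body T \<subseteq> e ` topspace X"
    proof
      fix z assume z: "z \<in> body T"
      have "\<exists>x\<in>topspace X. \<forall>\<beta><\<alpha>. e x \<beta> = z \<beta>" for \<alpha>
        using restr_T[of "Some \<circ> z" \<alpha>] z by (fastforce simp: body_def)
      then obtain y where "y \<in> topspace X" "\<And>\<beta>. \<beta> \<in> UNIV \<Longrightarrow> e y \<beta> = z \<beta>"
        using branch_coding_complete[OF cod limit_ordinals_UNIV[OF adm]] by metis
      then have "y \<in> topspace X" "e y = z" by auto
      then show "z \<in> e ` topspace X" by blast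
    qed
  qed
  define C where "C = body T"
  have C: "superclosed C"
    using T closedin_body by (auto simp: superclosed_def C_def)
  have top_C: "topspace (subtopology bounded_topology C) = e ` topspace X"
    by (simp add: topspace_bounded_topology C_def body)
  have "homeomorphic_map X (subtopology bounded_topology C) e"
  proof (rule bijective_open_imp_homeomorphic_map)
    show "e ` topspace X = topspace (subtopology bounded_topology C)" using top_C by simp
    show "inj_on e (topspace X)" by (rule branch_coding_inj[OF cod])
    show "continuous_map X (subtopology bounded_topology C) e"
    proof (rule continuous_map_into_subtopology)
      show "e \<in> topspace X \<rightarrow> C" by (auto simp: C_def body)
      show "continuous_map X bounded_topology e"
        unfolding continuous_map_def topspace_bounded_topology
      proof (intro conjI allI impI)
        fix V :: "('k \<Rightarrow> 'k) set" assume V: "openin bounded_topology V"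
        have "\<exists>\<alpha>. cylinder X e x \<alpha> \<subseteq> {x \<in> topspace X. e x \<in> V}" if "e x \<in> V" for x
        proof -
          obtain \<alpha> where "{y. \<forall>\<beta><\<alpha>. y \<beta> = e x \<beta>} \<subseteq> V"
            using V \<open>e x \<in> V\<close> unfolding openin_bounded_topology by blast
          then show ?thesis by (intro exI[of _ \<alpha>]) (auto simp: cylinder_def)
        qed
        then show "openin X {x \<in> topspace X. e x \<in> V}"
          unfolding branch_coding_open[OF cod] by auto
      qed simp
    qed
    show "open_map X (subtopology bounded_topology C) e"
      unfolding open_map_def
    proof (intro allI impI)
      fix U assume U: "openin X U"
      then have "\<forall>x\<in>U. \<exists>\<alpha>. cylinder X e x \<alpha> \<subseteq> U"
        by (simp add: branch_coding_open[OF cod])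
      then show "openin (subtopology bounded_topology C) (e ` U)"
        using openin_image_bounded_topology[OF branch_coding_inj[OF cod] openin_subset[OF U]]
        by (simp add: C_def body)
    qed
  qed
  then have "X homeomorphic_space subtopology bounded_topology C"
    by (rule homeomorphic_map_imp_homeomorphic_space)
  with C show ?thesis by blast
qed

section \<open>The first-difference metric\<close>

text \<open>
  The distance of two points is \<open>\<epsilon>\<^sub>\<beta>\<close>, where \<open>\<beta>\<close> is the first place at which their codes differ and
  \<open>\<epsilon>\<close> is a strictly decreasing coinitial sequence.  Balls are cylinders, so the centres of a chain of
  balls agree on ever longer initial segments and approximate a sequence whose length is the
  supremum of the lengths of the cylinders.  If the supremum is attained, the corresponding centre
  lies in all the balls; otherwise it is a limit, and branch completeness yields a point.  A Cauchy
  sequence is treated in the same way, with limit length \<open>\<kappa>\<close>.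
\<close>

lemma branch_coding_imp_spherically_complete:
  fixes e :: "'a \<Rightarrow> 'k::wellorder \<Rightarrow> 'k"
  assumes adm: "admissible_cardinal TYPE('k)"
    and deg: "has_Deg TYPE('g::linordered_ab_group_add) (kappa :: 'k rel)"
    and cod: "branch_coding X e"
  shows "\<exists>d :: 'a \<Rightarrow> 'a \<Rightarrow> 'g. compatible X d \<and> Cauchy_complete TYPE('k) (topspace X) d \<and>
           spherically_complete (topspace X) d"
proof -
  obtain \<epsilon> :: "'k \<Rightarrow> 'g" where \<epsilon>: "\<And>\<alpha>. 0 < \<epsilon> \<alpha>" "\<And>\<alpha> \<beta>. \<alpha> < \<beta> \<Longrightarrow> \<epsilon> \<beta> < \<epsilon> \<alpha>"
    "\<And>r. 0 < r \<Longrightarrow> \<exists>\<alpha>. \<epsilon> \<alpha> < r"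
    using coinitial_sequence[OF adm deg] by blast
  define d where "d x y = (if e x = e y then 0 else \<epsilon> (LEAST \<beta>. e x \<beta> \<noteq> e y \<beta>))" for x y
  define len where "len r = (LEAST \<alpha>. \<epsilon> \<alpha> < r)" for r
  have len: "\<epsilon> (len r) < r" if "0 < r" for r
    unfolding len_def using \<epsilon>(3)[OF that] by (rule LeastI_ex)
  have len_least: "r \<le> \<epsilon> \<beta>" if "\<beta> < len r" for r \<beta>
    using not_less_Least[of \<beta> "\<lambda>\<alpha>. \<epsilon> \<alpha> < r"] that by (simp add: len_def not_less)
  have less_len: "\<alpha> < len (\<epsilon> \<alpha>)" for \<alpha>
  proof (rule ccontr)
    assume "\<not> \<alpha> < len (\<epsilon> \<alpha>)"
    then have "\<epsilon> \<alpha> \<le> \<epsilon> (len (\<epsilon> \<alpha>))"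
      using \<epsilon>(2)[of "len (\<epsilon> \<alpha>)" \<alpha>] by (auto simp: not_less le_less)
    with len[OF \<epsilon>(1)[of \<alpha>]] show False by simp
  qed
  (* A ball is a cylinder of length len r; the topology, completeness and the ultrametric inequality follow from this. *)
  have d_less: "d x y < r \<longleftrightarrow> (\<forall>\<beta><len r. e x \<beta> = e y \<beta>)" if r: "0 < r" for x y r
  proof (cases "e x = e y")
    case False
    define \<Delta> where "\<Delta> = (LEAST \<beta>. e x \<beta> \<noteq> e y \<beta>)"
    have \<Delta>: "e x \<Delta> \<noteq> e y \<Delta>"
      unfolding \<Delta>_def using False by (intro LeastI_ex[of "\<lambda>\<beta>. e x \<beta> \<noteq> e y \<beta>"]) auto
    have below: "e x \<beta> = e y \<beta>" if "\<beta> < \<Delta>" for \<beta>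
      using not_less_Least that unfolding \<Delta>_def by blast
    have "(\<forall>\<beta><len r. e x \<beta> = e y \<beta>) \<longleftrightarrow> len r \<le> \<Delta>"
      using \<Delta> below by (meson not_less order_less_le_trans)
    also have "\<dots> \<longleftrightarrow> \<epsilon> \<Delta> < r"
      using len[OF r] len_least[of \<Delta> r] \<epsilon>(2)[of "len r" \<Delta>] by (cases "len r" \<Delta> rule: linorder_cases) auto
    finally show ?thesis using False by (simp add: d_def \<Delta>_def)
  qed (simp add: d_def r)
  have d_nonneg: "0 \<le> d x y" for x y
    using \<epsilon>(1) by (auto simp: d_def less_imp_le)
  have ultra: "d x z \<le> max (d x y) (d y z)" for x y z
  proof (rule ccontr)
    assume "\<not> ?thesis"
    then have *: "d x y < d x z" "d y z < d x z" by (auto simp: le_max_iff_disj not_le)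
    then have pos: "0 < d x z" using d_nonneg[of x y] by simp
    then have "d x z < d x z" using * d_less[OF pos] by metis
    then show False by simp
  qed
  have gball: "gball (topspace X) d x r = cylinder X e x (len r)" if "0 < r" for x r
    using d_less[OF that] by (auto simp: gball_def cylinder_def)
  have gm: "gmetric_on (topspace X) d"
    unfolding gmetric_on_def
  proof (intro conjI ballI)
    fix x y z assume xy: "x \<in> topspace X" "y \<in> topspace X"
    show "0 \<le> d x y" by (rule d_nonneg)
    have "d x y \<noteq> 0" if "e x \<noteq> e y"
      using that \<epsilon>(1) by (simp add: d_def) (metis less_irrefl)
    then show "d x y = 0 \<longleftrightarrow> x = y"
      using inj_onD[OF branch_coding_inj[OF cod] _ xy] by (auto simp: d_def)
    show "d x y = d y x"
      unfolding d_def by (simp add: eq_commute)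
    have "max (d x y) (d y z) \<le> d x y + d y z"
      using d_nonneg by simp
    with ultra show "d x z \<le> d x y + d y z" by (rule order_trans)
  qed
  have top: "X = topology_generated_by (gballs (topspace X) d)"
    unfolding topology_eq
  proof
    fix U
    have "(\<exists>\<alpha>. cylinder X e x \<alpha> \<subseteq> U) \<longleftrightarrow> (\<exists>r>0. gball (topspace X) d x r \<subseteq> U)" for x
    proof
      assume "\<exists>\<alpha>. cylinder X e x \<alpha> \<subseteq> U"
      then obtain \<alpha> where "cylinder X e x \<alpha> \<subseteq> U" by blast
      moreover have "cylinder X e x (len (\<epsilon> \<alpha>)) \<subseteq> cylinder X e x \<alpha>"
        using less_len[of \<alpha>] by (auto simp: cylinder_def)
      ultimately show "\<exists>r>0. gball (topspace X) d x r \<subseteq> U"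
        using \<epsilon>(1) gball by (intro exI[of _ "\<epsilon> \<alpha>"]) auto
    next
      assume "\<exists>r>0. gball (topspace X) d x r \<subseteq> U"
      then show "\<exists>\<alpha>. cylinder X e x \<alpha> \<subseteq> U" using gball by metis
    qed
    then show "openin X U \<longleftrightarrow> openin (topology_generated_by (gballs (topspace X) d)) U"
      using openin_gballs[OF gm, of U] has_Deg_pos[OF adm deg] branch_coding_open[OF cod] by simp
  qed
  have "Cauchy_complete TYPE('k) (topspace X) d"
    unfolding Cauchy_complete_def
  proof (intro allI impI, elim conjE)
    fix u :: "'k \<Rightarrow> 'a" assume u: "range u \<subseteq> topspace X" and Cau: "gCauchy d u"
    have "\<forall>\<alpha>. \<exists>N. \<forall>\<beta>\<ge>N. \<forall>\<gamma>\<ge>N. d (u \<beta>) (u \<gamma>) < \<epsilon> \<alpha>"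
      using Cau \<epsilon>(1) by (auto simp: gCauchy_def)
    then obtain N where N: "\<And>\<alpha> \<beta> \<gamma>. N \<alpha> \<le> \<beta> \<Longrightarrow> N \<alpha> \<le> \<gamma> \<Longrightarrow> d (u \<beta>) (u \<gamma>) < \<epsilon> \<alpha>" by metis
    have agree: "e (u \<beta>) \<delta> = e (u \<gamma>) \<delta>" if "N \<alpha> \<le> \<beta>" "N \<alpha> \<le> \<gamma>" "\<delta> \<le> \<alpha>" for \<alpha> \<beta> \<gamma> \<delta>
      using N[OF that(1,2)] d_less[OF \<epsilon>(1)[of \<alpha>]] less_len[of \<alpha>] that(3) by auto
    define z where "z \<alpha> = e (u (N \<alpha>)) \<alpha>" for \<alpha>
    have z: "e (u \<beta>) \<delta> = z \<delta>" if "N \<alpha> \<le> \<beta>" "\<delta> \<le> \<alpha>" for \<alpha> \<beta> \<delta>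
    proof -
      let ?M = "max \<beta> (N \<delta>)"
      have "e (u \<beta>) \<delta> = e (u ?M) \<delta>"
        by (rule agree[of \<alpha>]) (use that in \<open>auto simp: le_max_iff_disj\<close>)
      also have "\<dots> = z \<delta>"
        unfolding z_def by (rule agree[of \<delta>]) auto
      finally show ?thesis .
    qed
    have "\<exists>x\<in>topspace X. \<forall>\<beta><\<alpha>. e x \<beta> = z \<beta>" for \<alpha>
      using u z[of \<alpha> "N \<alpha>"] by (intro bexI[of _ "u (N \<alpha>)"]) auto
    then obtain l where l: "l \<in> topspace X" "\<And>\<beta>. e l \<beta> = z \<beta>"
      using branch_coding_complete[OF cod limit_ordinals_UNIV[OF adm], of z] by (metis UNIV_I)
    have "limitin X u l at_top"
      unfolding limitin_def
    proof (intro conjI allI impI)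
      show "l \<in> topspace X" by fact
      fix U assume "openin X U \<and> l \<in> U"
      then obtain \<alpha> where \<alpha>: "cylinder X e l \<alpha> \<subseteq> U"
        using branch_coding_open[OF cod] by blast
      have "u \<beta> \<in> U" if "N \<alpha> \<le> \<beta>" for \<beta>
      proof -
        have "u \<beta> \<in> cylinder X e l \<alpha>"
          using u z[OF that] l(2) by (auto simp: cylinder_def)
        with \<alpha> show ?thesis by blast
      qed
      then show "\<forall>\<^sub>F \<beta> in at_top. u \<beta> \<in> U"
        unfolding eventually_at_top_linorder by blast
    qed
    then show "\<exists>l. limitin (topology_generated_by (gballs (topspace X) d)) u l at_top"
      unfolding top[symmetric] by blast
  qed
  moreover have "spherically_complete (topspace X) d"
    unfolding spherically_complete_def
  proof (intro allI impI, elim conjE)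
    fix R :: "'a set rel" and B
    assume wo: "Well_order R" and ne: "Field R \<noteq> {}"
      and balls: "\<forall>i\<in>Field R. B i \<in> gballs (topspace X) d" and dec: "\<forall>(i, j)\<in>R. B j \<subseteq> B i"
    have "\<forall>i\<in>Field R. \<exists>x l. x \<in> topspace X \<and> B i = cylinder X e x l"
      using balls gball unfolding gballs_def by blast
    then obtain c l where c: "\<And>i. i \<in> Field R \<Longrightarrow> c i \<in> topspace X"
      and B: "\<And>i. i \<in> Field R \<Longrightarrow> B i = cylinder X e (c i) (l i)" by metis
    have agree: "e (c i) \<beta> = e (c j) \<beta>"
      if ij: "i \<in> Field R" "j \<in> Field R" and \<beta>: "\<beta> < l i" "\<beta> < l j" for i j \<beta>
    proof -
      have "i = j \<or> (i, j) \<in> R \<or> (j, i) \<in> R"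
        using wo ij by (auto simp: well_order_on_def linear_order_on_def total_on_def)
      then have "B i \<subseteq> B j \<or> B j \<subseteq> B i" using dec by blast
      moreover have "c i \<in> B i" "c j \<in> B j"
        using c B ij by (simp_all add: cylinder_def)
      ultimately have "c i \<in> B j \<or> c j \<in> B i" by blast
      then show ?thesis using B ij \<beta> by (auto simp: cylinder_def)
    qed
    show "(\<Inter>i\<in>Field R. B i) \<noteq> {}"
    proof (cases "\<exists>i\<in>Field R. \<forall>j\<in>Field R. l j \<le> l i")
      case True
      then obtain i where i: "i \<in> Field R" "\<forall>j\<in>Field R. l j \<le> l i" by blast
      have "c i \<in> B j" if "j \<in> Field R" for j
      proof -
        have "\<beta> < l i" if "\<beta> < l j" for \<beta>
          using i(2) \<open>j \<in> Field R\<close> that by (meson order_less_le_trans)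
        then show ?thesis
          using agree[OF i(1) that] c[OF i(1)] B[OF that] by (simp add: cylinder_def)
      qed
      then show ?thesis by blast
    next
      case False
      define \<Gamma> where "\<Gamma> = {\<beta>. \<exists>i\<in>Field R. \<beta> < l i}"
      have l_mem: "l i \<in> \<Gamma>" if "i \<in> Field R" for i
        using False that by (auto simp: \<Gamma>_def not_le)
      have lim: "\<Gamma> \<in> limit_ordinals"
      proof -
        have "\<Gamma> \<in> insert UNIV (range lessThan)"
          by (rule down_closed_ordinal) (auto simp: \<Gamma>_def dest: less_trans)
        moreover have "\<Gamma> \<noteq> {}" using l_mem ne by blast
        moreover have "\<exists>\<beta>\<in>\<Gamma>. \<alpha> < \<beta>" if "\<alpha> \<in> \<Gamma>" for \<alpha>
          using that l_mem unfolding \<Gamma>_def by blast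
        ultimately show ?thesis by (simp add: limit_ordinals_def)
      qed
      have "\<forall>\<beta>\<in>\<Gamma>. \<exists>i. i \<in> Field R \<and> \<beta> < l i" by (auto simp: \<Gamma>_def)
      then obtain k where k: "\<And>\<beta>. \<beta> \<in> \<Gamma> \<Longrightarrow> k \<beta> \<in> Field R \<and> \<beta> < l (k \<beta>)" by metis
      define z where "z \<beta> = e (c (k \<beta>)) \<beta>" for \<beta>
      have z: "e (c i) \<beta> = z \<beta>" if "i \<in> Field R" "\<beta> < l i" for i \<beta>
      proof -
        have "\<beta> \<in> \<Gamma>" using that by (auto simp: \<Gamma>_def)
        with k that show ?thesis unfolding z_def by (intro agree) auto
      qed
      have "\<exists>x\<in>topspace X. \<forall>\<beta><\<alpha>. e x \<beta> = z \<beta>" if "\<alpha> \<in> \<Gamma>" for \<alpha>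
        using k[OF that] z c by (intro bexI[of _ "c (k \<alpha>)"]) (auto dest: less_trans)
      then obtain y where y: "y \<in> topspace X" "\<And>\<beta>. \<beta> \<in> \<Gamma> \<Longrightarrow> e y \<beta> = z \<beta>"
        using branch_coding_complete[OF cod lim, of z] by metis
      have "y \<in> B i" if "i \<in> Field R" for i
      proof -
        have "e y \<beta> = e (c i) \<beta>" if "\<beta> < l i" for \<beta>
          using y(2)[of \<beta>] z[OF \<open>i \<in> Field R\<close> that] that \<open>i \<in> Field R\<close> by (auto simp: \<Gamma>_def)
        then show ?thesis using B[OF that] y(1) by (simp add: cylinder_def)
      qed
      then show ?thesis by blast
    qed
  qed
  ultimately show ?thesis
    using gm top by (auto simp: compatible_def)
qed

lemma spherically_complete_imp_below:
  assumes "spherically_complete S d"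
  shows "spherically_complete_below TYPE('k::wellorder) S d"
  unfolding spherically_complete_below_def
proof (intro allI impI, elim conjE)
  fix \<alpha> :: 'k and B :: "'k \<Rightarrow> 'a set"
  assume ne: "{..<\<alpha>} \<noteq> {}" and balls: "\<forall>\<beta><\<alpha>. B \<beta> \<in> gballs S d"
    and dec: "\<forall>\<gamma><\<alpha>. \<forall>\<beta>\<le>\<gamma>. B \<gamma> \<subseteq> B \<beta>"
  define r where "r = {(\<beta>, \<gamma>). \<beta> \<le> \<gamma> \<and> \<gamma> < \<alpha>}"
  have F: "Field r = {..<\<alpha>}" by (auto simp: r_def Field_def)
  have "wf (r - Id)"
    by (rule wf_subset[OF wf]) (auto simp: r_def)
  then have "Well_order r"
    unfolding well_order_on_def linear_order_on_def partial_order_on_def preorder_on_def F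
    by (auto simp: r_def refl_on_def trans_def antisym_def total_on_def)
  then have "(\<Inter>i\<in>Field r. B i) \<noteq> {}"
    using spherically_complete_any_length[OF assms, of r B] ne balls dec
    by (auto simp: F) (auto simp: r_def)
  then show "(\<Inter>\<beta>\<in>{..<\<alpha>}. B \<beta>) \<noteq> {}" by (simp add: F)
qed

section \<open>Player II wins on spherically \<open><\<kappa>\<close>-complete spaces\<close>

lemma reply_cong:
  assumes "\<And>\<gamma>. \<gamma> \<le> \<beta> \<Longrightarrow> p \<gamma> = q \<gamma>"
  shows "reply \<sigma> p \<beta> = reply \<sigma> q \<beta>"
proof -
  have "(Some \<circ> p) |` {..\<beta>} = (Some \<circ> q) |` {..\<beta>}"
    using assms by (auto simp: restrict_map_def)
  then show ?thesis by (simp add: reply_def)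
qed

text \<open>
  In round \<open>\<alpha>\<close> player II answers with a ball of radius at most \<open>\<epsilon>\<^sub>\<alpha>\<close> around the point just played,
  so small that the ball of twice that radius stays inside the open set just played.  At limits
  below \<open>\<kappa>\<close> spherical completeness applies to the answers.  In a play of length \<open>\<kappa>\<close> the centres form a
  Cauchy sequence.  Its limit could lie on the boundary of the answers, and this is what the
  doubling excludes: the closure of an answer is contained in the open set played before it, hence
  in all earlier answers.
\<close>

lemma spherically_complete_below_imp_winning:
  fixes d :: "'a \<Rightarrow> 'a \<Rightarrow> 'g::linordered_ab_group_add"
  assumes adm: "admissible_cardinal TYPE('k::wellorder)"
    and deg: "has_Deg TYPE('g::linordered_ab_group_add) (kappa :: 'k rel)"
    and comp: "compatible X d" and Cau: "Cauchy_complete TYPE('k) (topspace X) d"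
    and sph: "spherically_complete_below TYPE('k) (topspace X) d"
  shows "\<exists>\<sigma> :: ('k, 'a) strategy. winning_II X \<sigma>"
proof -
  obtain \<epsilon> :: "'k \<Rightarrow> 'g" where \<epsilon>: "\<And>\<alpha>. 0 < \<epsilon> \<alpha>" "\<And>\<alpha> \<beta>. \<alpha> < \<beta> \<Longrightarrow> \<epsilon> \<beta> < \<epsilon> \<alpha>"
    "\<And>r. 0 < r \<Longrightarrow> \<exists>\<alpha>. \<epsilon> \<alpha> < r"
    using coinitial_sequence[OF adm deg] by blast
  note open_iff = openin_compatible[OF adm deg comp]
  have gm: "gmetric_on (topspace X) d" using comp by (simp add: compatible_def)
  have d_refl: "d x x = 0" and d_sym: "d x y = d y x" and d_tri: "d x z \<le> d x y + d y z"
    if "x \<in> topspace X" "y \<in> topspace X" "z \<in> topspace X" for x y z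
    using gm that by (auto simp: gmetric_on_def)
  have half: "\<exists>s>0. s + s \<le> r" if r: "0 < r" for r :: 'g
  proof -
    obtain \<alpha> where "\<epsilon> \<alpha> < r" using \<epsilon>(3)[OF r] by blast
    then show ?thesis
      using \<epsilon>(1)[of \<alpha>]
      by (intro exI[of _ "min (\<epsilon> \<alpha>) (r - \<epsilon> \<alpha>)"])
        (auto intro: order_trans[OF add_mono[OF min.cobounded1 min.cobounded2]])
  qed
  let ?ball = "gball (topspace X) d"
  define good where "good U x \<alpha> r \<longleftrightarrow> 0 < r \<and> r \<le> \<epsilon> \<alpha> \<and> ?ball x (r + r) \<subseteq> U" for U x \<alpha> r
  have good_ex: "\<exists>r. good U x \<alpha> r" if U: "openin X U" "x \<in> U" for U x \<alpha>
  proof -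
    obtain \<delta> where \<delta>: "\<delta> > 0" "?ball x \<delta> \<subseteq> U" using U open_iff by blast
    obtain s where s: "s > 0" "s + s \<le> \<delta>" using half[OF \<delta>(1)] by blast
    have "min s (\<epsilon> \<alpha>) + min s (\<epsilon> \<alpha>) \<le> \<delta>"
      using s(2) add_mono[of "min s (\<epsilon> \<alpha>)" s "min s (\<epsilon> \<alpha>)" s] by simp
    with \<delta>(2) have "?ball x (min s (\<epsilon> \<alpha>) + min s (\<epsilon> \<alpha>)) \<subseteq> U" by (auto simp: gball_def)
    with s \<epsilon>(1)[of \<alpha>] show ?thesis
      by (intro exI[of _ "min s (\<epsilon> \<alpha>)"]) (simp add: good_def)
  qed
  define rad where "rad U x \<alpha> = (SOME r. good U x \<alpha> r)" for U x \<alpha>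
  (* The round is recovered from the history as the greatest element of its domain. *)
  define \<sigma> :: "('k, 'a) strategy" where
    "\<sigma> h = (let \<alpha> = (GREATEST \<alpha>. \<alpha> \<in> dom h); (U, x) = the (h \<alpha>) in ?ball x (rad U x \<alpha>))" for h
  have reply: "reply \<sigma> p \<alpha> = ?ball (snd (p \<alpha>)) (rad (fst (p \<alpha>)) (snd (p \<alpha>)) \<alpha>)" for p \<alpha>
  proof -
    have "(GREATEST \<beta>. \<beta> \<in> dom ((Some \<circ> p) |` {..\<alpha>})) = \<alpha>"
      by (rule Greatest_equality) auto
    then show ?thesis by (simp add: reply_def \<sigma>_def case_prod_unfold Let_def)
  qed
  have step: "openin X (fst (p \<alpha>)) \<and> openin X (reply \<sigma> p \<alpha>) \<and> snd (p \<alpha>) \<in> reply \<sigma> p \<alpha> \<and>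
      reply \<sigma> p \<alpha> \<subseteq> fst (p \<alpha>) \<and> (\<forall>\<beta><\<alpha>. fst (p \<alpha>) \<subseteq> reply \<sigma> p \<beta>) \<and>
      good (fst (p \<alpha>)) (snd (p \<alpha>)) \<alpha> (rad (fst (p \<alpha>)) (snd (p \<alpha>)) \<alpha>)"
    if "\<forall>\<beta>\<le>\<alpha>. legal_I X \<sigma> p \<beta>" for p \<alpha>
    using that
  proof (induction \<alpha> rule: less_induct)
    case (less \<alpha>)
    obtain O1 where O1: "openin X O1" "fst (p \<alpha>) = O1 \<inter> (\<Inter>\<beta>\<in>{..<\<alpha>}. reply \<sigma> p \<beta>)"
      and mem: "snd (p \<alpha>) \<in> fst (p \<alpha>)"
      using less.prems by (auto simp: legal_I_def arena_def openin_subtopology)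
    have "openin X {y \<in> topspace X. \<forall>\<beta><\<alpha>. y \<in> reply \<sigma> p \<beta>}"
      by (rule additive_INT[OF adm compatible_imp_additive[OF adm deg comp]])
        (use less in auto)
    moreover have "fst (p \<alpha>) = O1 \<inter> {y \<in> topspace X. \<forall>\<beta><\<alpha>. y \<in> reply \<sigma> p \<beta>}"
      using O1 openin_subset[OF O1(1)] by auto
    ultimately have op: "openin X (fst (p \<alpha>))" using O1(1) by auto
    then have inX: "snd (p \<alpha>) \<in> topspace X" using mem openin_subset by blast
    let ?r = "rad (fst (p \<alpha>)) (snd (p \<alpha>)) \<alpha>"
    have good: "good (fst (p \<alpha>)) (snd (p \<alpha>)) \<alpha> ?r"
      unfolding rad_def using good_ex[OF op mem] by (rule someI_ex)
    then have "?r > 0" by (simp add: good_def)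
    have "?ball (snd (p \<alpha>)) ?r \<in> gballs (topspace X) d"
      using inX \<open>?r > 0\<close> by (auto simp: gballs_def)
    then have "openin X (reply \<sigma> p \<alpha>)"
      using comp topology_generated_by_Basis unfolding reply compatible_def by metis
    moreover have "snd (p \<alpha>) \<in> reply \<sigma> p \<alpha>"
      using inX \<open>?r > 0\<close> d_refl by (simp add: reply gball_def)
    moreover have "reply \<sigma> p \<alpha> \<subseteq> fst (p \<alpha>)"
    proof -
      have "?ball (snd (p \<alpha>)) ?r \<subseteq> ?ball (snd (p \<alpha>)) (?r + ?r)"
        using \<open>?r > 0\<close> by (auto simp: gball_def add_strict_increasing intro: less_trans)
      with good show ?thesis by (auto simp: reply good_def)
    qed
    ultimately show ?case using op good O1(2) by auto
  qed
  have "legal_II X \<sigma> p \<alpha>" if "\<forall>\<beta>\<le>\<alpha>. legal_I X \<sigma> p \<beta>" for p \<alpha>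
  proof -
    note st = step[OF that]
    have "reply \<sigma> p \<alpha> = reply \<sigma> p \<alpha> \<inter> (\<Inter>\<beta>\<in>{..<\<alpha>}. reply \<sigma> p \<beta>)" using st by blast
    then show ?thesis using st by (auto simp: legal_II_def arena_def openin_subtopology)
  qed
  moreover have "(\<Inter>\<alpha>\<in>\<Gamma>. reply \<sigma> p \<alpha>) \<noteq> {}"
    if \<Gamma>: "\<Gamma> \<in> limit_ordinals" and leg: "\<forall>\<alpha>\<in>\<Gamma>. legal_I X \<sigma> p \<alpha>" for p \<Gamma>
  proof -
    have st: "openin X (fst (p \<alpha>))" "openin X (reply \<sigma> p \<alpha>)" "snd (p \<alpha>) \<in> reply \<sigma> p \<alpha>"
      "reply \<sigma> p \<alpha> \<subseteq> fst (p \<alpha>)" "\<And>\<beta>. \<beta> < \<alpha> \<Longrightarrow> fst (p \<alpha>) \<subseteq> reply \<sigma> p \<beta>"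
      "good (fst (p \<alpha>)) (snd (p \<alpha>)) \<alpha> (rad (fst (p \<alpha>)) (snd (p \<alpha>)) \<alpha>)" if "\<alpha> \<in> \<Gamma>" for \<alpha>
      using step[of \<alpha> p] leg limit_ordinals_down[OF \<Gamma> that] by auto
    have inX: "snd (p \<alpha>) \<in> topspace X" if "\<alpha> \<in> \<Gamma>" for \<alpha>
      using st(2,3)[OF that] openin_subset by blast
    have mono: "reply \<sigma> p \<gamma> \<subseteq> reply \<sigma> p \<beta>" if "\<gamma> \<in> \<Gamma>" "\<beta> \<le> \<gamma>" for \<beta> \<gamma>
      using st(4,5)[OF that(1)] that(2) by (auto simp: le_less)
    show ?thesis
    proof (cases "\<Gamma> = UNIV")
      case False
      with \<Gamma> obtain \<gamma> where \<gamma>: "\<Gamma> = {..<\<gamma>}" by (auto simp: limit_ordinals_def)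
      moreover have "reply \<sigma> p \<beta> \<in> gballs (topspace X) d" if "\<beta> \<in> \<Gamma>" for \<beta>
        using inX[OF that] st(6)[OF that] by (auto simp: reply gballs_def good_def)
      moreover have "\<Gamma> \<noteq> {}" using \<Gamma> by (simp add: limit_ordinals_def)
      ultimately show ?thesis
        using sph mono unfolding spherically_complete_below_def by auto
    next
      case True
      define u where "u \<alpha> = snd (p \<alpha>)" for \<alpha>
      have u: "u \<beta> \<in> reply \<sigma> p \<alpha>" if "\<alpha> \<le> \<beta>" for \<alpha> \<beta>
        using mono[of \<beta> \<alpha>] st(3)[of \<beta>] that True by (auto simp: u_def)
      have uX: "u \<alpha> \<in> topspace X" for \<alpha> using inX True by (simp add: u_def)
      define r where "r \<alpha> = rad (fst (p \<alpha>)) (snd (p \<alpha>)) \<alpha>" for \<alpha>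
      have r: "0 < r \<alpha>" "r \<alpha> \<le> \<epsilon> \<alpha>" "?ball (u \<alpha>) (r \<alpha> + r \<alpha>) \<subseteq> fst (p \<alpha>)" for \<alpha>
        using st(6)[of \<alpha>] True by (simp_all add: r_def good_def u_def)
      have close: "d (u \<alpha>) (u \<beta>) < r \<alpha>" if "\<alpha> \<le> \<beta>" for \<alpha> \<beta>
        using u[OF that] by (simp add: reply gball_def u_def r_def)
      have "gCauchy d u"
        unfolding gCauchy_def
      proof (intro allI impI)
        fix q :: 'g assume "0 < q"
        then obtain s where s: "s > 0" "s + s \<le> q" using half by blast
        then obtain \<alpha> where \<alpha>: "\<epsilon> \<alpha> < s" using \<epsilon>(3) by blast
        have "d (u \<beta>) (u \<gamma>) < q" if "\<beta> \<ge> \<alpha>" "\<gamma> \<ge> \<alpha>" for \<beta> \<gamma>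
        proof -
          have "d (u \<beta>) (u \<gamma>) \<le> d (u \<alpha>) (u \<beta>) + d (u \<alpha>) (u \<gamma>)"
            using d_tri[OF uX uX uX] d_sym[OF uX uX uX] by metis
          also have "\<dots> < s + s"
            using close[OF that(1)] close[OF that(2)] r(2)[of \<alpha>] \<alpha>
            by (intro add_strict_mono) auto
          finally show ?thesis using s(2) by simp
        qed
        then show "\<exists>\<alpha>. \<forall>\<beta>\<ge>\<alpha>. \<forall>\<gamma>\<ge>\<alpha>. d (u \<beta>) (u \<gamma>) < q" by blast
      qed
      moreover have "X = topology_generated_by (gballs (topspace X) d)"
        using comp by (simp add: compatible_def)
      ultimately obtain l where l: "limitin X u l at_top"
        using Cau uX unfolding Cauchy_complete_def by (metis image_subsetI)
      then have lX: "l \<in> topspace X" by (simp add: limitin_def)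
      have "l \<in> fst (p \<alpha>)" for \<alpha>
      proof -
        let ?N = "?ball l (r \<alpha>)"
        have "?N \<in> gballs (topspace X) d" using lX r(1) by (auto simp: gballs_def)
        then have "openin X ?N"
          using comp topology_generated_by_Basis unfolding compatible_def by metis
        moreover have "l \<in> ?N" using lX r(1) d_refl by (simp add: gball_def)
        ultimately have "\<forall>\<^sub>F \<beta> in at_top. u \<beta> \<in> ?N" using l by (auto simp: limitin_def)
        then obtain M where M: "\<And>\<beta>. M \<le> \<beta> \<Longrightarrow> u \<beta> \<in> ?N"
          unfolding eventually_at_top_linorder by blast
        define \<beta> where "\<beta> = max M \<alpha>"
        have "d (u \<alpha>) l \<le> d (u \<alpha>) (u \<beta>) + d l (u \<beta>)"
          using d_tri[OF uX uX lX] d_sym[OF uX lX lX] by metis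
        also have "\<dots> < r \<alpha> + r \<alpha>"
          using close[of \<alpha> \<beta>] M[of \<beta>] by (intro add_strict_mono) (auto simp: \<beta>_def gball_def)
        finally show ?thesis using r(3)[of \<alpha>] lX by (auto simp: gball_def)
      qed
      moreover have "\<exists>\<beta>. \<alpha> < \<beta>" for \<alpha> :: 'k by (rule no_last_ordinal[OF adm])
      ultimately have "l \<in> reply \<sigma> p \<alpha>" for \<alpha>
        using st(5) True by blast
      then show ?thesis by blast
    qed
  qed
  ultimately have "winning_II X \<sigma>" unfolding winning_II_def by blast
  then show ?thesis by blast
qed

section \<open>Clopen bases of additive spaces\<close>

text \<open>As \<open>\<kappa>\<close> is uncountable, a \<open>\<kappa>\<close>-additive topology is closed under countable intersections.  Shrinking
  a neighbourhood \<open>\<omega>\<close> times, each time keeping the closure inside the previous set, gives an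
  intersection that is both open and closed.\<close>

lemma additive_clopen_neighbourhood:
  assumes adm: "admissible_cardinal TYPE('k::wellorder)" and add: "additive_space (kappa :: 'k rel) X"
    and reg: "regular_space X" and U: "openin X U" "x \<in> U"
  obtains C where "openin X C" "closedin X C" "x \<in> C" "C \<subseteq> U"
proof -
  let ?P = "\<lambda>V. openin X V \<and> x \<in> V"
  have shrink: "\<exists>W. ?P W \<and> X closure_of W \<subseteq> V" if V: "?P V" for V
  proof -
    have "closedin X (topspace X - V)" "x \<in> topspace X - (topspace X - V)"
      using V openin_subset by blast+
    then obtain W W' where W: "openin X W" "openin X W'" "x \<in> W" "topspace X - V \<subseteq> W'" "disjnt W W'"
      using reg[unfolded regular_space_def, rule_format, of "topspace X - V" x] by blast
    have "X closure_of W \<subseteq> topspace X - W'"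
      by (rule closure_of_minimal) (use W openin_subset[OF W(1)] in \<open>auto simp: disjnt_def\<close>)
    with W show ?thesis by blast
  qed
  have "\<exists>V :: nat \<Rightarrow> 'a set. \<forall>n. (?P (V n) \<and> (n = 0 \<longrightarrow> V n = U)) \<and> X closure_of V (Suc n) \<subseteq> V n"
  proof (rule dependent_nat_choice)
    show "\<exists>V. ?P V \<and> ((0::nat) = 0 \<longrightarrow> V = U)" using U by blast
    fix V and n :: nat assume "?P V \<and> (n = 0 \<longrightarrow> V = U)"
    then have "\<exists>W. ?P W \<and> X closure_of W \<subseteq> V" by (intro shrink) simp
    then show "\<exists>W. (?P W \<and> (Suc n = 0 \<longrightarrow> W = U)) \<and> X closure_of W \<subseteq> V" by auto
  qed
  then obtain V :: "nat \<Rightarrow> 'a set" where V: "V 0 = U" "\<And>n. openin X (V n)" "\<And>n. x \<in> V n"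
    "\<And>n. X closure_of V (Suc n) \<subseteq> V n" by blast
  define C where "C = (\<Inter>n. V n)"
  have "|range V| \<le>o natLeq"
    by (rule ordLeq_ordIso_trans[OF card_of_image card_of_nat])
  then have "|range V| <o (kappa :: 'k rel)"
    using adm by (auto simp: admissible_cardinal_def intro: ordLeq_ordLess_trans)
  then have "openin X (topspace X \<inter> \<Inter>(range V))"
    using add V(2) by (auto simp: additive_space_def)
  moreover have "topspace X \<inter> \<Inter>(range V) = C"
    using V(2)[of 0] openin_subset by (fastforce simp: C_def)
  ultimately have "openin X C" by simp
  moreover have "C = (\<Inter>n. X closure_of V n)"
  proof
    show "C \<subseteq> (\<Inter>n. X closure_of V n)"
      using closure_of_subset[OF openin_subset[OF V(2)]] by (fastforce simp: C_def)
    show "(\<Inter>n. X closure_of V n) \<subseteq> C"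
      using V(4) by (fastforce simp: C_def)
  qed
  then have "closedin X C" by auto
  ultimately show thesis
    using that V(1,3) by (auto simp: C_def)
qed

text \<open>
  A base of size at most \<open>\<kappa>\<close> can be replaced by a clopen one, again of size at most \<open>\<kappa>\<close>: for each pair of
  basic sets choose, if possible, one clopen set between them.
\<close>

lemma additive_clopen_base:
  assumes adm: "admissible_cardinal TYPE('k::wellorder)" and add: "additive_space (kappa :: 'k rel) X"
    and reg: "regular_space X" and weight: "weight_le X (kappa :: 'k rel)"
  obtains B :: "'k::wellorder \<Rightarrow> 'a set" where "\<And>j. openin X (B j)" "\<And>j. closedin X (B j)"
    "\<And>U x. openin X U \<Longrightarrow> x \<in> U \<Longrightarrow> \<exists>j. x \<in> B j \<and> B j \<subseteq> U"
proof -
  obtain \<B> where \<B>: "|\<B>| \<le>o (kappa :: 'k rel)" "\<And>V. V \<in> \<B> \<Longrightarrow> openin X V"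
    "\<And>U x. openin X U \<Longrightarrow> x \<in> U \<Longrightarrow> \<exists>V\<in>\<B>. x \<in> V \<and> V \<subseteq> U"
    using weight unfolding weight_le_def by (elim exE conjE) simp
  define between where "between = (\<lambda>(V, V') C. openin X C \<and> closedin X C \<and> V \<subseteq> C \<and> C \<subseteq> V')"
  define c where "c P = (if \<exists>C. between P C then SOME C. between P C else {})" for P
  have c: "between P (c P)" if "between P C" for P C
    using someI_ex[of "between P"] that unfolding c_def by auto
  have clopen: "openin X (c P) \<and> closedin X (c P)" for P
  proof (cases "\<exists>C. between P C")
    case True
    then obtain C where "between P C" by blast
    then have "between P (c P)" by (rule c)
    then show ?thesis by (simp add: between_def case_prod_unfold)
  qed (simp add: c_def)
  have "|\<B> \<times> \<B>| \<le>o |UNIV :: 'k set|"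
  proof -
    have "|\<B>| \<le>o |UNIV :: 'k set|"
      using \<B>(1) ordIso_symmetric[OF kappa_card_UNIV[OF adm]] by (rule ordLeq_ordIso_trans)
    then obtain f :: "'a set \<Rightarrow> 'k" where "inj_on f \<B>"
      unfolding card_of_ordLeq[symmetric] by blast
    then have "inj_on (map_prod f f) (\<B> \<times> \<B>)" by (intro map_prod_inj_on)
    then have "|\<B> \<times> \<B>| \<le>o |UNIV \<times> UNIV :: ('k \<times> 'k) set|"
      unfolding card_of_ordLeq[symmetric] by blast
    then show ?thesis
      using card_of_Times_same_infinite[OF infinite_UNIV_kappa[OF adm]] by (rule ordLeq_ordIso_trans)
  qed
  then obtain f :: "'a set \<times> 'a set \<Rightarrow> 'k" where f: "inj_on f (\<B> \<times> \<B>)"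
    unfolding card_of_ordLeq[symmetric] by blast
  define B where "B j = c (inv_into (\<B> \<times> \<B>) f j)" for j
  have "\<exists>j. x \<in> B j \<and> B j \<subseteq> U" if U: "openin X U" "x \<in> U" for U x
  proof -
    obtain V' where V': "V' \<in> \<B>" "x \<in> V'" "V' \<subseteq> U" using \<B>(3) U by blast
    obtain C where C: "openin X C" "closedin X C" "x \<in> C" "C \<subseteq> V'"
      using additive_clopen_neighbourhood[OF adm add reg \<B>(2)[OF V'(1)] V'(2)] by blast
    obtain V where V: "V \<in> \<B>" "x \<in> V" "V \<subseteq> C" using \<B>(3) C by blast
    have "between (V, V') C" using C V by (simp add: between_def)
    then have "between (V, V') (c (V, V'))" by (rule c)
    moreover have "B (f (V, V')) = c (V, V')"
      unfolding B_def using inv_into_f_f[OF f, of "(V, V')"] V V' by simp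
    ultimately show ?thesis
      using V V' by (intro exI[of _ "f (V, V')"]) (auto simp: between_def)
  qed
  then show thesis using that[of B] clopen by (simp add: B_def)
qed

section \<open>Additive strong Choquet spaces have branch codings\<close>

lemma legal_I_cong:
  assumes "\<And>\<gamma>. \<gamma> \<le> \<beta> \<Longrightarrow> p \<gamma> = q \<gamma>"
  shows "legal_I X \<sigma> p \<beta> = legal_I X \<sigma> q \<beta>"
proof -
  have "reply \<sigma> p \<gamma> = reply \<sigma> q \<gamma>" if "\<gamma> < \<beta>" for \<gamma>
    by (rule reply_cong) (use assms that in auto)
  then have "arena X \<sigma> p \<beta> = arena X \<sigma> q \<beta>" by (simp add: arena_def)
  then show ?thesis using assms[of \<beta>] by (simp add: legal_I_def)
qed

text \<open>
  Here \<open>f \<beta> x\<close> consists of the label given to \<open>x\<close> at stage \<open>\<beta>\<close> and of the point that player I plays in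
  round \<open>\<beta>\<close> on behalf of \<open>x\<close>.  The cells of stage \<open>\<beta>\<close> are the classes of points not separated by
  earlier labels; they are also the sets that player I plays.
\<close>

definition cell :: "'a topology \<Rightarrow> ('k::wellorder \<Rightarrow> 'a \<Rightarrow> 'k \<times> 'a) \<Rightarrow> 'k \<Rightarrow> 'a \<Rightarrow> 'a set" where
  "cell X f \<beta> x = {y \<in> topspace X. \<forall>\<gamma><\<beta>. fst (f \<gamma> y) = fst (f \<gamma> x)}"

definition cell_play ::
    "'a topology \<Rightarrow> ('k::wellorder \<Rightarrow> 'a \<Rightarrow> 'k \<times> 'a) \<Rightarrow> 'a \<Rightarrow> 'k \<Rightarrow> 'a set \<times> 'a" where
  "cell_play X f x \<beta> = (cell X f \<beta> x, snd (f \<beta> x))"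

text \<open>
  Stage \<open>\<beta>\<close> splits each cell into open pieces, according to the labels assigned by \<open>r\<close>.  A piece must
  be contained in or disjoint from the basic set \<open>B \<beta>\<close>, so that the pieces eventually shrink to
  points, and must be contained in the answer of player II, so that branches of nested pieces are
  plays won by II.  All points of a piece must induce the same move: the play may depend on the labels only.
\<close>

definition good_stage ::
    "'a topology \<Rightarrow> ('k::wellorder, 'a) strategy \<Rightarrow> ('k \<Rightarrow> 'a set) \<Rightarrow> ('k \<Rightarrow> 'a \<Rightarrow> 'k \<times> 'a) \<Rightarrow>
      'k \<Rightarrow> ('a \<Rightarrow> 'k \<times> 'a) \<Rightarrow> bool" where
  "good_stage X \<sigma> B f \<beta> r \<longleftrightarrow> (\<forall>x\<in>topspace X.
     (let W = cell X f \<beta> x; K = {y \<in> W. fst (r y) = fst (r x)} in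
       snd (r x) \<in> W \<and> openin X K \<and> (K \<subseteq> B \<beta> \<or> K \<inter> B \<beta> = {}) \<and>
       K \<subseteq> reply \<sigma> ((cell_play X f x)(\<beta> := (W, snd (r x)))) \<beta> \<and> (\<forall>y\<in>K. snd (r y) = snd (r x))))"

lemma cell_cong:
  assumes "\<And>\<gamma>. \<gamma> < \<beta> \<Longrightarrow> f \<gamma> = g \<gamma>"
  shows "cell X f \<beta> x = cell X g \<beta> x"
  using assms by (auto simp: cell_def)

lemma good_stage_cong:
  assumes "\<And>\<gamma>. \<gamma> < \<beta> \<Longrightarrow> f \<gamma> = g \<gamma>"
  shows "good_stage X \<sigma> B f \<beta> r = good_stage X \<sigma> B g \<beta> r"
proof -
  have cell: "cell X f \<gamma> x = cell X g \<gamma> x" if "\<gamma> \<le> \<beta>" for \<gamma> x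
    by (rule cell_cong) (use assms that in auto)
  have "reply \<sigma> ((cell_play X f x)(\<beta> := m)) \<beta> = reply \<sigma> ((cell_play X g x)(\<beta> := m)) \<beta>" for x m
    by (rule reply_cong) (use cell assms in \<open>auto simp: cell_play_def\<close>)
  then show ?thesis by (simp add: good_stage_def cell)
qed

lemma good_stageD:
  assumes "good_stage X \<sigma> B f \<beta> (f \<beta>)" "x \<in> topspace X"
  shows "snd (f \<beta> x) \<in> cell X f \<beta> x"
    and "openin X {y \<in> cell X f \<beta> x. fst (f \<beta> y) = fst (f \<beta> x)}"
    and "\<And>y. y \<in> cell X f \<beta> x \<Longrightarrow> fst (f \<beta> y) = fst (f \<beta> x) \<Longrightarrow> y \<in> B \<beta> \<longleftrightarrow> x \<in> B \<beta>"
    and "\<And>y. y \<in> cell X f \<beta> x \<Longrightarrow> fst (f \<beta> y) = fst (f \<beta> x) \<Longrightarrow>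
           y \<in> reply \<sigma> (cell_play X f x) \<beta>"
    and "\<And>y. y \<in> cell X f \<beta> x \<Longrightarrow> fst (f \<beta> y) = fst (f \<beta> x) \<Longrightarrow> snd (f \<beta> y) = snd (f \<beta> x)"
proof -
  let ?K = "{y \<in> cell X f \<beta> x. fst (f \<beta> y) = fst (f \<beta> x)}"
  have "(cell_play X f x)(\<beta> := (cell X f \<beta> x, snd (f \<beta> x))) = cell_play X f x"
    by (auto simp: cell_play_def)
  note eq = this
  have *: "snd (f \<beta> x) \<in> cell X f \<beta> x" "openin X ?K" "?K \<subseteq> B \<beta> \<or> ?K \<inter> B \<beta> = {}"
    "?K \<subseteq> reply \<sigma> (cell_play X f x) \<beta>" "\<forall>y\<in>?K. snd (f \<beta> y) = snd (f \<beta> x)"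
    using bspec[OF assms(1)[unfolded good_stage_def Let_def] assms(2)] unfolding eq by blast+
  have "x \<in> ?K" using assms(2) by (simp add: cell_def)
  show "snd (f \<beta> x) \<in> cell X f \<beta> x" "openin X ?K" by (fact *)+
  fix y assume "y \<in> cell X f \<beta> x" "fst (f \<beta> y) = fst (f \<beta> x)"
  then have "y \<in> ?K" by simp
  with \<open>x \<in> ?K\<close> *(3-5) show "y \<in> B \<beta> \<longleftrightarrow> x \<in> B \<beta>" "y \<in> reply \<sigma> (cell_play X f x) \<beta>"
    "snd (f \<beta> y) = snd (f \<beta> x)" by blast+
qed

lemma cell_eq:
  "y \<in> cell X f \<beta> x \<Longrightarrow> \<gamma> \<le> \<beta> \<Longrightarrow> cell X f \<gamma> y = cell X f \<gamma> x"
  by (auto simp: cell_def)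

lemma cell_play_eq:
  assumes good: "\<And>\<gamma>. \<gamma> < \<beta> \<Longrightarrow> good_stage X \<sigma> B f \<gamma> (f \<gamma>)"
    and x: "x \<in> topspace X" and y: "y \<in> cell X f \<beta> x" and "\<gamma> < \<beta>"
  shows "cell_play X f y \<gamma> = cell_play X f x \<gamma>"
proof -
  have "y \<in> cell X f \<gamma> x" "fst (f \<gamma> y) = fst (f \<gamma> x)"
    using y \<open>\<gamma> < \<beta>\<close> by (auto simp: cell_def)
  then have "snd (f \<gamma> y) = snd (f \<gamma> x)"
    by (rule good_stageD(5)[OF good[OF \<open>\<gamma> < \<beta>\<close>] x])
  with cell_eq[OF y] \<open>\<gamma> < \<beta>\<close> show ?thesis by (simp add: cell_play_def)
qed

lemma openin_cell:
  assumes adm: "admissible_cardinal TYPE('k::wellorder)" and add: "additive_space (kappa :: 'k rel) X"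
    and good: "\<And>\<gamma>. \<gamma> < \<beta> \<Longrightarrow> good_stage X \<sigma> B f \<gamma> (f \<gamma>)" and x: "x \<in> topspace X"
  shows "openin X (cell X f (\<beta>::'k) x)"
proof -
  let ?K = "\<lambda>\<gamma>. {y \<in> cell X f \<gamma> x. fst (f \<gamma> y) = fst (f \<gamma> x)}"
  have "openin X {y \<in> topspace X. \<forall>\<gamma><\<beta>. y \<in> ?K \<gamma>}"
    by (rule additive_INT[OF adm add]) (rule good_stageD(2)[OF good x])
  also have "{y \<in> topspace X. \<forall>\<gamma><\<beta>. y \<in> ?K \<gamma>} = cell X f \<beta> x"
    by (auto simp: cell_def)
  finally show ?thesis .
qed

text \<open>Pieces lie in player II's answers, so the cell of stage \<open>\<beta>\<close> lies in all earlier answers and may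
  be played.\<close>

lemma legal_cell_play:
  assumes adm: "admissible_cardinal TYPE('k::wellorder)" and add: "additive_space (kappa :: 'k rel) X"
    and good: "\<And>\<gamma>. \<gamma> < \<beta> \<Longrightarrow> good_stage X \<sigma> B f \<gamma> (f \<gamma>)" and x: "x \<in> topspace X"
    and p: "\<And>\<gamma>. \<gamma> < \<beta> \<Longrightarrow> p \<gamma> = cell_play X f x \<gamma>" "p \<beta> = (cell X f \<beta> x, q)"
    and q: "q \<in> cell X f (\<beta>::'k) x"
  shows "legal_I X \<sigma> p \<beta>"
proof -
  have "cell X f \<beta> x \<subseteq> reply \<sigma> p \<gamma>" if \<gamma>: "\<gamma> < \<beta>" for \<gamma>
  proof -
    have "cell X f \<beta> x \<subseteq> reply \<sigma> (cell_play X f x) \<gamma>"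
    proof
      fix y assume "y \<in> cell X f \<beta> x"
      then have "y \<in> cell X f \<gamma> x" "fst (f \<gamma> y) = fst (f \<gamma> x)"
        using \<gamma> by (auto simp: cell_def)
      then show "y \<in> reply \<sigma> (cell_play X f x) \<gamma>"
        by (rule good_stageD(4)[OF good[OF \<gamma>] x])
    qed
    also have "reply \<sigma> (cell_play X f x) \<gamma> = reply \<sigma> p \<gamma>"
      by (rule reply_cong) (use p(1) \<gamma> in auto)
    finally show ?thesis .
  qed
  then have "cell X f \<beta> x = cell X f \<beta> x \<inter> (\<Inter>\<gamma>\<in>{..<\<beta>}. reply \<sigma> p \<gamma>)" by blast
  then have "openin (arena X \<sigma> p \<beta>) (cell X f \<beta> x)"
    unfolding arena_def openin_subtopology using openin_cell[OF adm add good x] by blast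
  then show ?thesis using p(2) q by (simp add: legal_I_def)
qed

text \<open>
  For every \<open>x\<close> in a cell \<open>W\<close> some clopen basic set around \<open>x\<close> is contained in or disjoint from
  \<open>B \<beta>\<close>, and its part in \<open>W\<close> is contained in player II's answer to \<open>(W, x)\<close>.  Labelling each point
  by the least suitable index of a basic set around it makes the cover of \<open>W\<close> by these basic sets
  disjoint.  Suitability of an index
  depends only on the cell, since the plays of its points coincide before stage \<open>\<beta>\<close>.
\<close>

lemma good_stage_exists:
  fixes B :: "'k::wellorder \<Rightarrow> 'a set"
  assumes adm: "admissible_cardinal TYPE('k)" and add: "additive_space (kappa :: 'k rel) X"
    and win: "winning_II X \<sigma>"
    and B: "\<And>j. openin X (B j)" "\<And>j. closedin X (B j)"
      "\<And>U x. openin X U \<Longrightarrow> x \<in> U \<Longrightarrow> \<exists>j. x \<in> B j \<and> B j \<subseteq> U"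
    and good: "\<And>\<gamma>. \<gamma> < \<beta> \<Longrightarrow> good_stage X \<sigma> B f \<gamma> (f \<gamma>)"
  shows "\<exists>r. good_stage X \<sigma> B f \<beta> r"
proof -
  define R where "R x q = reply \<sigma> ((cell_play X f x)(\<beta> := (cell X f \<beta> x, q))) \<beta>" for x q
  define suits where "suits x j q \<longleftrightarrow> q \<in> cell X f \<beta> x \<and> cell X f \<beta> x \<inter> B j \<subseteq> R x q \<and>
    (B j \<subseteq> B \<beta> \<or> B j \<inter> B \<beta> = {})" for x j q
  define label where "label x = (LEAST j. x \<in> B j \<and> (\<exists>q. suits x j q))" for x
  define pt where "pt x = (SOME q. suits x (label x) q)" for x
  have R: "openin X (R x q)" "q \<in> R x q" if x: "x \<in> topspace X" and q: "q \<in> cell X f \<beta> x" for x q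
  proof -
    let ?p = "(cell_play X f x)(\<beta> := (cell X f \<beta> x, q))"
    have "legal_I X \<sigma> ?p \<gamma>" if "\<gamma> \<le> \<beta>" for \<gamma>
    proof (cases "\<gamma> = \<beta>")
      case True
      show ?thesis unfolding True
        by (rule legal_cell_play[OF adm add good x _ _ q]) auto
    next
      case False
      with that have \<gamma>: "\<gamma> < \<beta>" by simp
      have "legal_I X \<sigma> (cell_play X f x) \<gamma>"
        by (rule legal_cell_play[OF adm add _ x, where f = f and B = B and q = "snd (f \<gamma> x)"])
          (use good good_stageD(1)[OF good[OF \<gamma>] x] \<gamma> in \<open>auto simp: cell_play_def\<close>)
      moreover have "legal_I X \<sigma> ?p \<gamma> = legal_I X \<sigma> (cell_play X f x) \<gamma>"
        by (rule legal_I_cong) (use \<gamma> in auto)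
      ultimately show ?thesis by simp
    qed
    then have I: "legal_I X \<sigma> ?p \<beta>" and II: "legal_II X \<sigma> ?p \<beta>"
      using win by (auto simp: winning_II_def)
    from II show "q \<in> R x q" by (simp add: legal_II_def R_def)
    obtain O1 where O1: "openin X O1" "R x q = O1 \<inter> (\<Inter>\<gamma>\<in>{..<\<beta>}. reply \<sigma> ?p \<gamma>)"
      using II by (auto simp: legal_II_def R_def arena_def openin_subtopology)
    have "cell X f \<beta> x \<subseteq> (\<Inter>\<gamma>\<in>{..<\<beta>}. reply \<sigma> ?p \<gamma>)"
      using I by (auto simp: legal_I_def arena_def openin_subtopology)
    moreover have "R x q \<subseteq> cell X f \<beta> x"
      using II by (simp add: legal_II_def R_def)
    ultimately have "R x q = O1 \<inter> cell X f \<beta> x" using O1(2) by blast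
    then show "openin X (R x q)"
      using O1(1) openin_cell[OF adm add good x] by auto
  qed
  have label: "x \<in> B (label x) \<and> (\<exists>q. suits x (label x) q)" if x: "x \<in> topspace X" for x
  proof -
    have xx: "x \<in> cell X f \<beta> x" using x by (simp add: cell_def)
    define U where "U = (if x \<in> B \<beta> then R x x \<inter> B \<beta> else R x x \<inter> (topspace X - B \<beta>))"
    have "openin X U" "x \<in> U"
      using R[OF x xx] x B(1,2)[of \<beta>] by (auto simp: U_def intro: openin_diff)
    then obtain j where j: "x \<in> B j" "B j \<subseteq> U" using B(3) by blast
    then have "suits x j x"
      using xx by (auto simp: suits_def U_def split: if_splits)
    with j(1) show ?thesis
      unfolding label_def by (intro LeastI_ex[of "\<lambda>j. x \<in> B j \<and> (\<exists>q. suits x j q)"]) blast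
  qed
  have pt: "suits x (label x) (pt x)" if "x \<in> topspace X" for x
    unfolding pt_def using label[OF that] by (auto intro: someI_ex)
  have suits_eq: "suits y = suits x" if x: "x \<in> topspace X" and y: "y \<in> cell X f \<beta> x" for x y
  proof -
    have "cell X f \<beta> y = cell X f \<beta> x" using cell_eq[OF y] by simp
    moreover have "R y = R x"
    proof
      fix q show "R y q = R x q"
        unfolding R_def
        by (rule reply_cong) (use cell_play_eq[OF good x y] calculation in auto)
    qed
    ultimately show ?thesis by (simp add: suits_def fun_eq_iff)
  qed
  have "good_stage X \<sigma> B f \<beta> (\<lambda>x. (label x, pt x))"
    unfolding good_stage_def Let_def fst_conv snd_conv
  proof (intro ballI conjI)
    fix x assume x: "x \<in> topspace X"
    let ?W = "cell X f \<beta> x" and ?K = "{y \<in> cell X f \<beta> x. label y = label x}"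
    have KB: "?K \<subseteq> ?W \<inter> B (label x)"
    proof
      fix y assume y: "y \<in> ?K"
      then have "y \<in> topspace X" by (simp add: cell_def)
      with label y show "y \<in> ?W \<inter> B (label x)" by (metis (mono_tags, lifting) IntI mem_Collect_eq)
    qed
    show "pt x \<in> ?W" "?K \<subseteq> reply \<sigma> ((cell_play X f x)(\<beta> := (?W, pt x))) \<beta>"
      using pt[OF x] KB by (auto simp: suits_def R_def)
    show "?K \<subseteq> B \<beta> \<or> ?K \<inter> B \<beta> = {}"
      using pt[OF x] KB by (auto simp: suits_def)
    show "pt y = pt x" if "y \<in> ?K" for y
      using that suits_eq[OF x, of y] by (simp add: pt_def)
    (* The label is the least suitable index, so ?K arises from ?W \<inter> B (label x) by removing
       the fewer than \<kappa> clopen sets with smaller suitable indices. *)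
    define D where "D i = (if \<exists>q. suits x i q then topspace X - B i else topspace X)" for i
    have "openin X {y \<in> topspace X. \<forall>i<label x. y \<in> D i}"
      by (rule additive_INT[OF adm add]) (use B(2) in \<open>auto simp: D_def\<close>)
    then have "openin X (?W \<inter> B (label x) \<inter> {y \<in> topspace X. \<forall>i<label x. y \<in> D i})"
      using openin_cell[OF adm add good x] B(1) by blast
    also have "?W \<inter> B (label x) \<inter> {y \<in> topspace X. \<forall>i<label x. y \<in> D i} = ?K" (is "?L = _")
    proof
      show "?K \<subseteq> ?L"
      proof
        fix y assume y: "y \<in> ?K"
        then have yX: "y \<in> topspace X" by (simp add: cell_def)
        have "y \<notin> B i" if "i < label x" "\<exists>q. suits x i q" for i
        proof -
          have "\<not> (y \<in> B i \<and> (\<exists>q. suits y i q))"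
            by (rule not_less_Least) (use that y in \<open>simp add: label_def\<close>)
          moreover have "suits y = suits x" using suits_eq[OF x] y by blast
          ultimately show ?thesis using that(2) by simp
        qed
        with y yX KB show "y \<in> ?L" by (auto simp: D_def)
      qed
      show "?L \<subseteq> ?K"
      proof
        fix y assume y: "y \<in> ?L"
        then have s: "suits y = suits x" by (intro suits_eq[OF x]) simp
        have "label y = label x"
          unfolding label_def[of y] s
        proof (rule Least_equality)
          show "y \<in> B (label x) \<and> (\<exists>q. suits x (label x) q)"
            using y label[OF x] by simp
          fix i assume "y \<in> B i \<and> (\<exists>q. suits x i q)"
          show "label x \<le> i"
          proof (rule ccontr)
            assume "\<not> label x \<le> i"
            with y have "y \<in> D i" by simp
            with \<open>y \<in> B i \<and> (\<exists>q. suits x i q)\<close> show False by (auto simp: D_def)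
          qed
        qed
        with y show "y \<in> ?K" by simp
      qed
    qed
    finally show "openin X ?K" .
  qed
  then show ?thesis by - (rule exI)
qed

text \<open>
  The code of a point is the sequence of its labels, and cylinders are cells.  A sequence
  approximated by codes of points determines a play of player I; as player II wins it, some point
  lies in all answers, hence in all cells along the sequence, and its labels are those of the
  sequence.
\<close>

lemma additive_SC_imp_branch_coding:
  fixes X :: "'a topology"
  assumes adm: "admissible_cardinal TYPE('k::wellorder)" and add: "additive_space (kappa :: 'k rel) X"
    and SC: "SC_space TYPE('k) X" and reg: "regular_space X" and haus: "Hausdorff_space X"
  shows "\<exists>e :: 'a \<Rightarrow> 'k \<Rightarrow> 'k. branch_coding X e"
proof -
  obtain \<sigma> :: "('k, 'a) strategy" where win: "winning_II X \<sigma>"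
    using SC by (auto simp: SC_space_def)
  have "weight_le X (kappa :: 'k rel)" using SC by (simp add: SC_space_def)
  then obtain B :: "'k \<Rightarrow> 'a set" where B: "\<And>j. openin X (B j)" "\<And>j. closedin X (B j)"
    "\<And>U x. openin X U \<Longrightarrow> x \<in> U \<Longrightarrow> \<exists>j. x \<in> B j \<and> B j \<subseteq> U"
    using additive_clopen_base[OF adm add reg] by blast
  have "\<exists>f. \<forall>\<beta>. good_stage X \<sigma> B f \<beta> (f \<beta>)"
    by (rule dependent_wellorder_choice)
      (rule good_stage_cong, assumption, rule good_stage_exists[OF adm add win B])
  then obtain f where good: "\<And>\<beta>. good_stage X \<sigma> B f \<beta> (f \<beta>)" by blast
  define e where "e x \<beta> = fst (f \<beta> x)" for x \<beta>
  have cyl: "cylinder X e x \<alpha> = cell X f \<alpha> x" for x \<alpha>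
    by (simp add: cylinder_def cell_def e_def)
  have nbhd: "\<exists>\<alpha>. cylinder X e x \<alpha> \<subseteq> U" if U: "openin X U" "x \<in> U" for U x
  proof -
    obtain j where j: "x \<in> B j" "B j \<subseteq> U" using B(3) U by blast
    obtain \<alpha> where \<alpha>: "j < \<alpha>" using no_last_ordinal[OF adm] by blast
    have x: "x \<in> topspace X" using U openin_subset by blast
    have "y \<in> B j" if "y \<in> cell X f \<alpha> x" for y
    proof -
      have "y \<in> cell X f j x" "fst (f j y) = fst (f j x)"
        using that \<alpha> by (auto simp: cell_def)
      then show ?thesis using good_stageD(3)[OF good x] j(1) by blast
    qed
    with j(2) show ?thesis by (auto simp: cyl)
  qed
  have "openin X U \<longleftrightarrow> U \<subseteq> topspace X \<and> (\<forall>x\<in>U. \<exists>\<alpha>. cylinder X e x \<alpha> \<subseteq> U)" for U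
  proof
    assume U: "U \<subseteq> topspace X \<and> (\<forall>x\<in>U. \<exists>\<alpha>. cylinder X e x \<alpha> \<subseteq> U)"
    show "openin X U"
    proof (subst openin_subopen, intro ballI)
      fix x assume "x \<in> U"
      with U obtain \<alpha> where "x \<in> topspace X" "cell X f \<alpha> x \<subseteq> U" unfolding cyl by blast
      moreover from this have "openin X (cell X f \<alpha> x)" by (intro openin_cell[OF adm add good])
      moreover have "x \<in> cell X f \<alpha> x" using calculation(1) by (simp add: cell_def)
      ultimately show "\<exists>V. openin X V \<and> x \<in> V \<and> V \<subseteq> U" by blast
    qed
  qed (use nbhd openin_subset in blast)
  moreover have "inj_on e (topspace X)"
  proof (rule inj_onI, rule ccontr)
    fix x y assume xy: "x \<in> topspace X" "y \<in> topspace X" "e x = e y" "x \<noteq> y"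
    then obtain U V where "openin X U" "openin X V" "x \<in> U" "y \<in> V" "disjnt U V"
      using haus unfolding Hausdorff_space_def by metis
    moreover from this obtain \<alpha> where "cylinder X e x \<alpha> \<subseteq> U" using nbhd by blast
    moreover have "y \<in> cylinder X e x \<alpha>" using xy by (simp add: cylinder_def)
    ultimately show False by (auto simp: disjnt_iff)
  qed
  moreover have "\<exists>y\<in>topspace X. \<forall>\<beta>\<in>\<Gamma>. e y \<beta> = z \<beta>"
    if \<Gamma>: "\<Gamma> \<in> limit_ordinals" and approx: "\<forall>\<alpha>\<in>\<Gamma>. \<exists>x\<in>topspace X. \<forall>\<beta><\<alpha>. e x \<beta> = z \<beta>" for \<Gamma> z
  proof -
    have "\<exists>x\<in>topspace X. \<forall>\<gamma>\<le>\<beta>. e x \<gamma> = z \<gamma>" if "\<beta> \<in> \<Gamma>" for \<beta>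
    proof -
      obtain \<alpha> where "\<alpha> \<in> \<Gamma>" "\<beta> < \<alpha>" using \<Gamma> \<open>\<beta> \<in> \<Gamma>\<close> by (auto simp: limit_ordinals_def)
      with approx show ?thesis by (meson order_le_less_trans)
    qed
    then obtain h where h: "\<And>\<beta>. \<beta> \<in> \<Gamma> \<Longrightarrow> h \<beta> \<in> topspace X"
      "\<And>\<beta> \<gamma>. \<beta> \<in> \<Gamma> \<Longrightarrow> \<gamma> \<le> \<beta> \<Longrightarrow> e (h \<beta>) \<gamma> = z \<gamma>" by metis
    (* The points h \<beta> change along the play, but the moves made on their behalf cohere. *)
    define p where "p \<beta> = cell_play X f (h \<beta>) \<beta>" for \<beta>
    have p: "p \<gamma> = cell_play X f (h \<beta>) \<gamma>" if \<beta>: "\<beta> \<in> \<Gamma>" "\<gamma> \<le> \<beta>" for \<beta> \<gamma>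
    proof (cases "\<gamma> = \<beta>")
      case False
      have \<gamma>: "\<gamma> \<in> \<Gamma>" using limit_ordinals_down[OF \<Gamma> \<beta>] .
      have agree: "fst (f \<delta> (h \<beta>)) = fst (f \<delta> (h \<gamma>))" if "\<delta> \<le> \<gamma>" for \<delta>
        using h(2)[OF \<beta>(1), of \<delta>] h(2)[OF \<gamma>, of \<delta>] that \<beta>(2) by (simp add: e_def)
      then have mem: "h \<beta> \<in> cell X f \<gamma> (h \<gamma>)"
        using h(1)[OF \<beta>(1)] by (simp add: cell_def)
      then have "snd (f \<gamma> (h \<beta>)) = snd (f \<gamma> (h \<gamma>))"
        using good_stageD(5)[OF good h(1)[OF \<gamma>]] agree by simp
      with cell_eq[OF mem order_refl] show ?thesis by (simp add: p_def cell_play_def)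
    qed (simp add: p_def)
    have leg: "legal_I X \<sigma> p \<beta>" if "\<beta> \<in> \<Gamma>" for \<beta>
      by (rule legal_cell_play[OF adm add good h(1)[OF that], where q = "snd (f \<beta> (h \<beta>))"])
        (use p[OF that] good_stageD(1)[OF good h(1)[OF that]] in \<open>auto simp: cell_play_def\<close>)
    then have "(\<Inter>\<beta>\<in>\<Gamma>. reply \<sigma> p \<beta>) \<noteq> {}"
      using win \<Gamma> by (simp add: winning_II_def)
    then obtain y where y: "\<And>\<beta>. \<beta> \<in> \<Gamma> \<Longrightarrow> y \<in> reply \<sigma> p \<beta>" by blast
    have y_cell: "y \<in> cell X f \<beta> (h \<beta>)" if "\<beta> \<in> \<Gamma>" for \<beta>
    proof -
      have "legal_II X \<sigma> p \<beta>"
        using win leg limit_ordinals_down[OF \<Gamma> that] by (auto simp: winning_II_def)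
      then have "reply \<sigma> p \<beta> \<subseteq> fst (p \<beta>)" by (simp add: legal_II_def)
      with y[OF that] show ?thesis by (auto simp: p_def cell_play_def)
    qed
    obtain \<beta> where "\<beta> \<in> \<Gamma>" using \<Gamma> by (auto simp: limit_ordinals_def)
    then have "y \<in> topspace X" using y_cell by (auto simp: cell_def)
    moreover have "e y \<beta> = z \<beta>" if "\<beta> \<in> \<Gamma>" for \<beta>
    proof -
      obtain \<gamma> where \<gamma>: "\<gamma> \<in> \<Gamma>" "\<beta> < \<gamma>" using \<Gamma> \<open>\<beta> \<in> \<Gamma>\<close> by (auto simp: limit_ordinals_def)
      then have "e y \<beta> = e (h \<gamma>) \<beta>" using y_cell by (auto simp: cell_def e_def)
      with h(2)[of \<gamma> \<beta>] \<gamma> show ?thesis by simp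
    qed
    ultimately show ?thesis by blast
  qed
  ultimately have "branch_coding X e" by (simp add: branch_coding_def)
  then show ?thesis by blast
qed

section \<open>The equivalences\<close>

theorem theorem2p30:
  fixes X :: "'a topology"
  assumes "admissible_cardinal TYPE('k::wellorder)"
    and "has_Deg TYPE('g::linordered_ab_group_add) (kappa :: 'k rel)"
    and "regular_space X" and "Hausdorff_space X"
  shows "(additive_space (kappa :: 'k rel) X \<and> SC_space TYPE('k) X \<longleftrightarrow>
            SC_space TYPE('k) X \<and> G_Polish TYPE('k) TYPE('g) X) \<and>
         (SC_space TYPE('k) X \<and> G_Polish TYPE('k) TYPE('g) X \<longleftrightarrow>
            spherically_complete_below_G_Polish TYPE('k) TYPE('g) X) \<and>
         (spherically_complete_below_G_Polish TYPE('k) TYPE('g) X \<longleftrightarrow>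
            spherically_complete_G_Polish TYPE('k) TYPE('g) X) \<and>
         (spherically_complete_G_Polish TYPE('k) TYPE('g) X \<longleftrightarrow>
            (\<exists>C :: ('k \<Rightarrow> 'k) set. superclosed C \<and>
               X homeomorphic_space subtopology bounded_topology C))"
proof -
  let ?a = "additive_space (kappa :: 'k rel) X \<and> SC_space TYPE('k) X"
  let ?b = "SC_space TYPE('k) X \<and> G_Polish TYPE('k) TYPE('g) X"
  let ?c = "spherically_complete_below_G_Polish TYPE('k) TYPE('g) X"
  let ?d = "spherically_complete_G_Polish TYPE('k) TYPE('g) X"
  let ?e = "\<exists>C :: ('k \<Rightarrow> 'k) set. superclosed C \<and> X homeomorphic_space subtopology bounded_topology C"
  note adm = assms(1) and deg = assms(2)
  have "?e" if ?a
    using additive_SC_imp_branch_coding[OF adm _ _ assms(3,4)] that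
      branch_coding_imp_homeomorphic_superclosed[OF adm] by blast
  moreover have "?d" if ?e
  proof -
    obtain e :: "'a \<Rightarrow> 'k \<Rightarrow> 'k" where cod: "branch_coding X e"
      using homeomorphic_superclosed_imp_branch_coding[OF adm] \<open>?e\<close> by blast
    then show ?thesis
      using branch_coding_imp_spherically_complete[OF adm deg cod] branch_coding_weight[OF adm cod]
      unfolding spherically_complete_G_Polish_def G_Polish_def by blast
  qed
  moreover have "?c" if ?d
    using that spherically_complete_imp_below
    unfolding spherically_complete_G_Polish_def spherically_complete_below_G_Polish_def by blast
  moreover have "?b" if ?c
    using that spherically_complete_below_imp_winning[OF adm deg]
    unfolding spherically_complete_below_G_Polish_def G_Polish_def SC_space_def by blast
  moreover have "?a" if ?b
    using that compatible_imp_additive[OF adm deg] unfolding G_Polish_def by blast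
  ultimately show ?thesis by argo
qed

end
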